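(* Let $G$ be a connected graph with three distinct vertices $v$, $u$, $w$, let $n\geq 1$ be an integer, and let $\mathcal{G}_n$ be the (second kind of) fan-like graph built from $n$ copies of $G$. Write $T(\cdot)=T(\cdot;x,y)$ for the Tutte polynomial and put \begin{align*} A&=\frac{1}{xy-x-y}\big((xy-x-1)T(G)-T(G/\{v,w\})\big),\\ B&=\frac{1}{xy-x-y}\big((x-1)T(G/\{v,w\})-T(G)\big),\\ C&=\frac{1}{xy-x-y}\big((xy-x-1)T(G/\{v,u\})-T(G/\{v,u,w\})\big),\\ D&=\frac{1}{xy-x-y}\big((x-1)T(G/\{v,u,w\})-T(G/\{v,u\})\big),\\ \lambda_{1,2}&=\frac{A+D\pm\sqrt{(A-D)^2+4BC}}{2}. \end{align*} Then $$T(\mathcal{G}_n)=T(G)\frac{\lambda^n_1-\lambda^n_2}{\lambda_1-\lambda_2}+\big(BT(G/\{v,u\})-DT(G)\big)\frac{\lambda^{n-1}_1-\lambda^{n-1}_2}{\lambda_1-\lambda_2},$$ and equivalently \begin{align*} T(\mathcal{G}_n)=&\big(BT(G/\{v,u\})-DT(G)\big)\sum_{j=0}^{\lfloor \frac{n-2}{2}\rfloor}\binom{n-j-2}{j}(A+D)^{n-2j-2}(BC-AD)^{j}\\ &+T(G)\sum_{j=0}^{\lfloor \frac{n-1}{2}\rfloor}\binom{n-j-1}{j}(A+D)^{n-2j-1}(BC-AD)^{j}. \end{align*}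
   Context: Graphs are finite; loops and multiple edges are allowed. The Tutte polynomial of a graph $G=(V,E)$ is $T(G;x,y)=\sum_{S\subseteq E}(x-1)^{r(E)-r(S)}(y-1)^{|S|-r(S)}$, where $r(S)=|V|-\omega(V,S)$ and $\omega(V,S)$ is the number of connected components of $(V,S)$. For $S\subseteq V$, $G/S$ denotes the graph obtained from $G$ by identifying all vertices of $S$ into one new vertex, with all edges preserved (edges inside $S$ become loops). Fan-like graph $\mathcal{G}_n$: let $H_1,\dots,H_n$ be disjoint copies of $G$. Identify the $n$ copies of $v$ into one vertex, and for each $i=1,\dots,n-1$ add an edge $e_i$ joining the copy of $w$ in $H_i$ to the copy of $u$ in $H_{i+1}$. In particular $\mathcal{G}_1=G$. Identities are between elements of an algebraic closure of $\mathbb{Q}(x,y)$; empty sums are $0$. *)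

theory Defs
  imports
    "HOL-Library.Uprod"
    "HOL-Computational_Algebra.Computational_Algebra"
    "HOL-Algebra.Algebraic_Closure_Type"
begin

text \<open>
  Finite undirected graphs with loops and multiple edges. Edges are named, and every edge has an
  unordered pair of ends; a loop at \<open>a\<close> is an edge with ends \<open>Upair a a\<close>.
\<close>

record ('v, 'e) mgraph =
  verts :: "'v set"
  edges :: "'e set"
  ends :: "'e \<Rightarrow> 'v uprod"

definition finite_mgraph :: "('v, 'e) mgraph \<Rightarrow> bool" where
  "finite_mgraph G \<longleftrightarrow>
     finite (verts G) \<and> finite (edges G) \<and> (\<forall>e\<in>edges G. set_uprod (ends G e) \<subseteq> verts G)"

definition adj_rel :: "('v, 'e) mgraph \<Rightarrow> 'e set \<Rightarrow> ('v \<times> 'v) set" where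
  "adj_rel G S = {(a, b). \<exists>e\<in>S. ends G e = Upair a b}"

definition conn_rel :: "('v, 'e) mgraph \<Rightarrow> 'e set \<Rightarrow> ('v \<times> 'v) set" where
  "conn_rel G S = (verts G \<times> verts G) \<inter> (adj_rel G S)\<^sup>*"

definition num_components :: "('v, 'e) mgraph \<Rightarrow> 'e set \<Rightarrow> nat" where
  "num_components G S = card (verts G // conn_rel G S)"

definition connected_mgraph :: "('v, 'e) mgraph \<Rightarrow> bool" where
  "connected_mgraph G \<longleftrightarrow> num_components G (edges G) = 1"

text \<open>The natural number subtractions below never truncate when the graph is finite.\<close>

definition graph_rank :: "('v, 'e) mgraph \<Rightarrow> 'e set \<Rightarrow> nat" where
  "graph_rank G S = card (verts G) - num_components G S"

definition tutte :: "('v, 'e) mgraph \<Rightarrow> 'a::comm_ring_1 \<Rightarrow> 'a \<Rightarrow> 'a" where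
  "tutte G x y = (\<Sum>S\<in>Pow (edges G).
     (x - 1) ^ (graph_rank G (edges G) - graph_rank G S) * (y - 1) ^ (card S - graph_rank G S))"

text \<open>\<open>None\<close> is the new vertex that replaces the vertices of \<open>S\<close>.\<close>

definition merge :: "'v set \<Rightarrow> 'v \<Rightarrow> 'v option" where
  "merge S a = (if a \<in> S then None else Some a)"

definition identify :: "('v, 'e) mgraph \<Rightarrow> 'v set \<Rightarrow> ('v option, 'e) mgraph" where
  "identify G S =
     \<lparr>verts = merge S ` verts G, edges = edges G, ends = (\<lambda>e. map_uprod (merge S) (ends G e))\<rparr>"

definition copies :: "nat \<Rightarrow> ('v, 'e) mgraph \<Rightarrow> (nat \<times> 'v, nat \<times> 'e) mgraph" where
  "copies n G =
     \<lparr>verts = {1..n} \<times> verts G,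
      edges = {1..n} \<times> edges G,
      ends = (\<lambda>(i, e). map_uprod (Pair i) (ends G e))\<rparr>"

text \<open>
  The fan-like graph. \<open>Inl (i, e)\<close> is the copy of \<open>e\<close> in the \<open>i\<close>-th copy of the graph, and \<open>Inr i\<close>
  is the additional edge from the \<open>i\<close>-th copy to the next one.
\<close>

definition fan ::
  "nat \<Rightarrow> ('v, 'e) mgraph \<Rightarrow> 'v \<Rightarrow> 'v \<Rightarrow> 'v \<Rightarrow> ((nat \<times> 'v) option, nat \<times> 'e + nat) mgraph" where
  "fan n G v u w =
     (let S = {1..n} \<times> {v}; H = identify (copies n G) S in
      \<lparr>verts = verts H,
       edges = Inl ` edges H \<union> Inr ` {1..<n},
       ends = (\<lambda>f. case f of
           Inl e \<Rightarrow> ends H e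
         | Inr i \<Rightarrow> Upair (merge S (i, w)) (merge S (i + 1, u)))\<rparr>)"

text \<open>
  An algebraic closure of \<open>\<rat>(x, y)\<close>, where \<open>\<rat>(x, y)\<close> is the fraction field of \<open>\<rat>[x][y]\<close>, and the two
  indeterminates in it.
\<close>

type_synonym ratfun_closure = "rat poly poly fract alg_closure"

definition indet_x :: ratfun_closure where
  "indet_x = to_ac (to_fract [:[:0, 1:]:])"

definition indet_y :: ratfun_closure where
  "indet_y = to_ac (to_fract [:0, 1:])"

definition T :: "('v, 'e) mgraph \<Rightarrow> ratfun_closure" where
  "T G = tutte G indet_x indet_y"

end

theory Submission
  imports Defs
begin

text \<open>
  The rank of an edge set \<open>S\<close> is governed by the cuts, that is, the vertex sets that are unions of
  components of the spanning subgraph with edge set \<open>S\<close>. The cuts that avoid a fixed root form a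
  vector space over the field with two elements under symmetric difference, and its dimension is the
  number of components minus one. Hence, with \<open>q = (x - 1) * (y - 1)\<close> and \<open>t = y - 1\<close>, the Tutte
  polynomial of a connected graph is up to a power of \<open>t\<close> the sum of \<open>q ^ d * t ^ card S\<close> over all
  \<open>S\<close>, where \<open>d\<close> is the dimension of the space of rooted cuts (\<open>tutte_eq_cut_sum\<close>). Identifying
  vertices with the root means that the cuts must avoid these vertices too
  (\<open>tutte_identify_eq_cut_sum\<close>), and gluing graphs becomes linear algebra.

  Take the hub of the fan as the root. A rooted cut of the fan is then a tuple of rooted cuts of the
  copies of \<open>G\<close> in which each edge between consecutive copies that is present imposes the linear
  condition that its ends lie on the same side (\<open>mem_rooted_cuts_fan\<close>). The effect of this condition on
  the dimension is determined by whether the two ends are connected to the hub in their copies, and it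
  is expressed by a formula that is bilinear in the data of the two sides (\<open>weight_product_agree\<close>).
  Therefore appending a copy acts as a two-by-two matrix on the pair consisting of the Tutte
  polynomial of the fan and the one of the fan with the last copy of \<open>w\<close> identified with the hub
  (\<open>tutte_fan_transfer\<close>).

  The entries of this matrix differ from \<open>A\<close>, \<open>B\<close>, \<open>C\<close>, \<open>D\<close>, which belong to a copy added at the
  front, but the trace is \<open>A + D\<close> and the determinant is \<open>A * D - B * C\<close>. By the Cayley-Hamilton theorem
  the Tutte polynomials of the fans satisfy a recurrence of order two with these coefficients, and
  both formulas are the solution of this recurrence, once in terms of the eigenvalues and once in
  terms of binomial coefficients. The first form divides by the difference of the eigenvalues. It is
  nonzero because the discriminant is: its numerator is a polynomial that takes a positive value at
  \<open>x = 2\<close>, \<open>y = 3\<close> (\<open>generic_discriminant_nonzero\<close>).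
\<close>

section \<open>Families of sets closed under symmetric difference\<close>

text \<open>
  Under symmetric difference the subsets of a set form a vector space over the field with two
  elements. The families below are its finite subspaces, and a predicate \<open>p\<close> that turns symmetric
  differences into exclusive disjunctions is a linear functional, whose kernel is
  \<open>{U \<in> C. \<not> p U}\<close>. All that the proof needs to know about connectivity in graphs is that such a
  kernel is either the whole space or half of it.
\<close>

definition cut_space :: "'a set set \<Rightarrow> bool" where
  "cut_space C \<longleftrightarrow> finite C \<and> {} \<in> C \<and> (\<forall>U\<in>C. \<forall>W\<in>C. sym_diff U W \<in> C)"

definition xor_linear :: "('a set \<Rightarrow> bool) \<Rightarrow> bool" where
  "xor_linear p \<longleftrightarrow> (\<forall>U W. p (sym_diff U W) \<longleftrightarrow> p U \<noteq> p W)"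

lemma xor_linear_mem: "xor_linear (\<lambda>U. a \<in> U)"
  by (auto simp: xor_linear_def)

lemma xor_linear_mem_neq: "xor_linear (\<lambda>U. (a \<in> U) \<noteq> (b \<in> U))"
  by (auto simp: xor_linear_def)

lemma xor_linear_empty: "xor_linear p \<Longrightarrow> \<not> p {}"
  unfolding xor_linear_def by (metis Diff_empty Un_empty_right)

lemma cut_space_kernel:
  assumes "cut_space C" "xor_linear p"
  shows "cut_space {U \<in> C. \<not> p U}"
  using assms xor_linear_empty[OF assms(2)] by (auto simp: cut_space_def xor_linear_def)

lemma card_filter_split: "finite C \<Longrightarrow> card C = card {U \<in> C. p U} + card {U \<in> C. \<not> p U}"
  by (subst card_Un_disjoint[symmetric]) (auto intro: arg_cong[where f = card])

text \<open>
  Adding a fixed element outside the kernel exchanges the kernel with its complement.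
\<close>

lemma card_kernel:
  assumes C: "cut_space C" and p: "xor_linear p" and U0: "U0 \<in> C" "p U0"
  shows "card C = 2 * card {U \<in> C. \<not> p U}"
proof -
  have fin: "finite C" using C by (simp add: cut_space_def)
  have "bij_betw (sym_diff U0) {U \<in> C. \<not> p U} {U \<in> C. p U}"
  proof (rule bij_betw_byWitness[where f' = "sym_diff U0"])
    show "sym_diff U0 ` {U \<in> C. \<not> p U} \<subseteq> {U \<in> C. p U}"
      using C p U0 unfolding cut_space_def xor_linear_def by blast
    show "sym_diff U0 ` {U \<in> C. p U} \<subseteq> {U \<in> C. \<not> p U}"
      using C p U0 unfolding cut_space_def xor_linear_def by blast
  qed auto
  then have eq: "card {U \<in> C. \<not> p U} = card {U \<in> C. p U}"
    by (rule bij_betw_same_card)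
  have "card C = card {U \<in> C. p U} + card {U \<in> C. \<not> p U}"
    using fin by (rule card_filter_split)
  with eq show ?thesis by simp
qed

lemma card_cut_space:
  assumes "cut_space C"
  shows "\<exists>d. card C = 2 ^ d"
  using assms
proof (induction "card C" arbitrary: C rule: less_induct)
  case less
  show ?case
  proof (cases "C = {{}}")
    case True
    then show ?thesis by (auto intro: exI[of _ 0])
  next
    case False
    then obtain U a where U: "U \<in> C" "a \<in> U"
      using less.prems by (auto simp: cut_space_def)
    let ?K = "{U \<in> C. a \<notin> U}"
    have c: "card C = 2 * card ?K"
      using card_kernel[OF less.prems xor_linear_mem U] .
    have K: "cut_space ?K"
      using cut_space_kernel[OF less.prems xor_linear_mem] .
    then have "card ?K > 0"
      by (auto simp: cut_space_def card_gt_0_iff)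
    then obtain d where "card ?K = 2 ^ d"
      using less.hyps[OF _ K] c by auto
    then show ?thesis using c by (auto intro: exI[of _ "Suc d"])
  qed
qed

text \<open>
  The dimension, read off from the cardinality. It is defined for sets of any type because it is
  also applied to sets of pairs of cuts.
\<close>

definition dim2 :: "'a set \<Rightarrow> nat" where
  "dim2 C = (THE d. card C = 2 ^ d)"

lemma dim2_eqI: "card C = 2 ^ d \<Longrightarrow> dim2 C = d"
  by (simp add: dim2_def)

lemma dim2_cong: "card C = card D \<Longrightarrow> dim2 C = dim2 D"
  by (simp add: dim2_def)

lemma card_eq_dim2: "cut_space C \<Longrightarrow> card C = 2 ^ dim2 C"
  using card_cut_space dim2_eqI by metis

lemma kernel_cases:
  assumes C: "cut_space C" and p: "xor_linear p"
  obtains "\<forall>U\<in>C. \<not> p U" "dim2 C = dim2 {U \<in> C. \<not> p U}" "card {U \<in> C. p U} = 0"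
  | "\<exists>U\<in>C. p U" "dim2 C = Suc (dim2 {U \<in> C. \<not> p U})"
    "card {U \<in> C. p U} = card {U \<in> C. \<not> p U}"
proof (cases "\<exists>U\<in>C. p U")
  case True
  have fin: "finite C" using C by (simp add: cut_space_def)
  have dbl: "card C = 2 * card {U \<in> C. \<not> p U}"
    using True card_kernel[OF C p] by blast
  have "card C = card {U \<in> C. p U} + card {U \<in> C. \<not> p U}"
    using fin by (rule card_filter_split)
  moreover have "dim2 C = Suc (dim2 {U \<in> C. \<not> p U})"
    using dbl card_eq_dim2[OF cut_space_kernel[OF C p]] by (intro dim2_eqI) simp
  ultimately show ?thesis using True dbl that(2) by simp
next
  case False
  then have "{U \<in> C. \<not> p U} = C" "{U \<in> C. p U} = {}" by blast+
  then have "dim2 C = dim2 {U \<in> C. \<not> p U}" "card {U \<in> C. p U} = 0"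
    by (simp_all only: card.empty)
  then show ?thesis using False that(1) by blast
qed

lemma dim2_kernel_le:
  assumes "cut_space C" "xor_linear p"
  shows "dim2 {U \<in> C. \<not> p U} \<le> dim2 C" and "dim2 C \<le> Suc (dim2 {U \<in> C. \<not> p U})"
  using assms by (cases rule: kernel_cases; simp)+

text \<open>
  The equation \<open>p U \<longleftrightarrow> p' W\<close> is one linear condition on the product space. It is void exactly if
  both functionals vanish, and otherwise it lowers the dimension by one.
\<close>

lemma card_product_agree:
  assumes C: "cut_space C" "xor_linear p" and D: "cut_space D" "xor_linear p'"
  shows "card {(U, W) \<in> C \<times> D. p U \<longleftrightarrow> p' W} =
    (if (\<forall>U\<in>C. \<not> p U) \<and> (\<forall>W\<in>D. \<not> p' W) then 2 ^ (dim2 C + dim2 D) else 2 ^ (dim2 C + dim2 D - 1))"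
proof -
  let ?C0 = "{U \<in> C. \<not> p U}" and ?C1 = "{U \<in> C. p U}"
  let ?D0 = "{U \<in> D. \<not> p' U}" and ?D1 = "{U \<in> D. p' U}"
  have fin: "finite C" "finite D" using C D by (simp_all add: cut_space_def)
  have "{(U, W) \<in> C \<times> D. p U \<longleftrightarrow> p' W} = ?C0 \<times> ?D0 \<union> ?C1 \<times> ?D1" by auto
  moreover have "(?C0 \<times> ?D0) \<inter> (?C1 \<times> ?D1) = {}" by auto
  ultimately have card: "card {(U, W) \<in> C \<times> D. p U \<longleftrightarrow> p' W} =
      card ?C0 * card ?D0 + card ?C1 * card ?D1"
    using fin by (simp add: card_Un_disjoint card_cartesian_product)
  define c0 where "c0 = dim2 ?C0"
  define d0 where "d0 = dim2 ?D0"
  have c: "card ?C0 = 2 ^ c0" and d: "card ?D0 = 2 ^ d0"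
    using card_eq_dim2[OF cut_space_kernel[OF C]] card_eq_dim2[OF cut_space_kernel[OF D]]
    by (simp_all only: c0_def d0_def)
  from C show ?thesis
  proof (cases rule: kernel_cases)
    case C': 1
    from D show ?thesis
    proof (cases rule: kernel_cases)
      case 1
      have "card {(U, W) \<in> C \<times> D. p U \<longleftrightarrow> p' W} = 2 ^ (dim2 C + dim2 D)"
        unfolding card C'(2,3)[folded c0_def] 1(2,3)[folded d0_def] c d by (simp add: power_add)
      then show ?thesis by (simp only: if_P[OF conjI[OF C'(1) 1(1)]])
    next
      case 2
      have "card {(U, W) \<in> C \<times> D. p U \<longleftrightarrow> p' W} = 2 ^ (dim2 C + dim2 D - 1)"
        unfolding card C'(2,3)[folded c0_def] 2(2,3)[folded d0_def] c d by (simp add: power_add)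
      moreover have "\<not> ((\<forall>U\<in>C. \<not> p U) \<and> (\<forall>W\<in>D. \<not> p' W))" using 2(1) by blast
      ultimately show ?thesis by (simp only: if_False)
    qed
  next
    case C': 2
    from D show ?thesis
    proof (cases rule: kernel_cases)
      case 1
      have "card {(U, W) \<in> C \<times> D. p U \<longleftrightarrow> p' W} = 2 ^ (dim2 C + dim2 D - 1)"
        unfolding card C'(2,3)[folded c0_def] 1(2,3)[folded d0_def] c d by (simp add: power_add)
      moreover have "\<not> ((\<forall>U\<in>C. \<not> p U) \<and> (\<forall>W\<in>D. \<not> p' W))" using C'(1) by blast
      ultimately show ?thesis by (simp only: if_False)
    next
      case 2
      have "card {(U, W) \<in> C \<times> D. p U \<longleftrightarrow> p' W} = 2 ^ (dim2 C + dim2 D - 1)"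
        unfolding card C'(2,3)[folded c0_def] 2(2,3)[folded d0_def] c d by (simp add: power_add)
      moreover have "\<not> ((\<forall>U\<in>C. \<not> p U) \<and> (\<forall>W\<in>D. \<not> p' W))" using C'(1) by blast
      ultimately show ?thesis by (simp only: if_False)
    qed
  qed
qed

text \<open>
  The case distinction of \<open>card_product_agree\<close> written as one identity that is bilinear in the weights
  of the two factors, so that it survives summation over edge sets. The expression
  \<open>q * q ^ dim2 K - q ^ dim2 C\<close>, with \<open>K\<close> the kernel, detects whether the functional vanishes on \<open>C\<close>: it
  is \<open>(q - 1) * q ^ dim2 C\<close> if it does and \<open>0\<close> if it does not.
\<close>

lemma weight_product_agree:
  fixes q :: "'k :: field"
  assumes C: "cut_space C" "xor_linear p" and D: "cut_space D" "xor_linear p'"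
    and q: "q \<noteq> 0" "q \<noteq> 1"
  shows "q ^ dim2 {(U, W) \<in> C \<times> D. p U \<longleftrightarrow> p' W} =
    q ^ dim2 C * q ^ dim2 D / q +
    (q * q ^ dim2 {U \<in> C. \<not> p U} - q ^ dim2 C) * (q * q ^ dim2 {W \<in> D. \<not> p' W} - q ^ dim2 D) /
      (q * (q - 1))"
proof (cases "(\<forall>U\<in>C. \<not> p U) \<and> (\<forall>W\<in>D. \<not> p' W)")
  case True
  then have "dim2 {(U, W) \<in> C \<times> D. p U \<longleftrightarrow> p' W} = dim2 C + dim2 D"
    using card_product_agree[OF C D] by (intro dim2_eqI) simp
  moreover have "{U \<in> C. \<not> p U} = C" "{W \<in> D. \<not> p' W} = D" using True by auto
  ultimately show ?thesis using q
    by (simp add: power_add divide_simps) (simp add: algebra_simps)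
next
  case False
  then have dim: "dim2 {(U, W) \<in> C \<times> D. p U \<longleftrightarrow> p' W} = dim2 C + dim2 D - 1"
    using card_product_agree[OF C D] by (intro dim2_eqI) (simp only: if_False)
  have drop: "dim2 C = Suc (dim2 {U \<in> C. \<not> p U}) \<or> dim2 D = Suc (dim2 {W \<in> D. \<not> p' W})"
    using False by (cases rule: kernel_cases[OF C]; cases rule: kernel_cases[OF D]) blast+
  then have "(q * q ^ dim2 {U \<in> C. \<not> p U} - q ^ dim2 C) *
      (q * q ^ dim2 {W \<in> D. \<not> p' W} - q ^ dim2 D) = 0" by auto
  moreover have "q ^ (dim2 C + dim2 D - 1) = q ^ dim2 C * q ^ dim2 D / q"
    using drop q by (auto simp: power_add)
  ultimately show ?thesis by (simp only: dim) simp
qed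

section \<open>The Tutte polynomial as a sum over rooted cuts\<close>

text \<open>
  The vertex sets that avoid \<open>R\<close> and are unions of components of the spanning subgraph with edge
  set \<open>S\<close>. A single root halves the space of all unions of components, which makes its dimension one
  less than the number of components; several roots have the effect of identifying them.
\<close>

definition rooted_cuts :: "('v, 'e) mgraph \<Rightarrow> 'v set \<Rightarrow> 'e set \<Rightarrow> 'v set set" where
  "rooted_cuts H R S =
     {U. U \<subseteq> verts H - R \<and> (\<forall>e\<in>S. \<forall>a b. ends H e = Upair a b \<longrightarrow> (a \<in> U \<longleftrightarrow> b \<in> U))}"

text \<open>
  The random cluster form of the Tutte polynomial, with \<open>C S\<close> the cut space of the edge set \<open>S\<close>. It
  avoids the subtractions in the exponents, and it is multiplicative for graphs that share a root.
\<close>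

definition cut_sum :: "'k::comm_ring_1 \<Rightarrow> 'k \<Rightarrow> 'e set \<Rightarrow> ('e set \<Rightarrow> 'c set) \<Rightarrow> 'k" where
  "cut_sum q t E C = (\<Sum>S\<in>Pow E. q ^ dim2 (C S) * t ^ card S)"

lemma rooted_cuts_insert_root:
  "rooted_cuts H (insert p R) S = {U \<in> rooted_cuts H R S. \<not> p \<in> U}"
  by (auto simp: rooted_cuts_def)

lemma rooted_cuts_insert_edge:
  assumes "ends H e = Upair a b"
  shows "rooted_cuts H R (insert e S) = {U \<in> rooted_cuts H R S. \<not> (a \<in> U) \<noteq> (b \<in> U)}"
  using assms by (auto simp: rooted_cuts_def)

lemma cut_space_rooted_cuts: "finite (verts H) \<Longrightarrow> cut_space (rooted_cuts H R S)"
  unfolding cut_space_def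
proof (intro conjI ballI)
  assume "finite (verts H)"
  then show "finite (rooted_cuts H R S)"
    by (rule finite_subset[rotated, OF finite_Pow_iff[THEN iffD2]]) (auto simp: rooted_cuts_def)
  show "{} \<in> rooted_cuts H R S" by (simp add: rooted_cuts_def)
next
  fix U W assume "U \<in> rooted_cuts H R S" "W \<in> rooted_cuts H R S"
  then show "sym_diff U W \<in> rooted_cuts H R S" unfolding rooted_cuts_def by fast
qed

lemma dim2_rooted_cuts_empty:
  assumes "finite (verts H)" "r \<in> verts H"
  shows "dim2 (rooted_cuts H {r} {}) = card (verts H) - 1"
proof -
  have "rooted_cuts H {r} {} = Pow (verts H - {r})" by (auto simp: rooted_cuts_def)
  then show ?thesis using assms by (intro dim2_eqI) (simp add: card_Pow)
qed

text \<open>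
  Each edge imposes one linear condition. The second bound is the fact that the nullity of an edge
  set is not negative.
\<close>

lemma dim2_rooted_cuts_bounds:
  assumes H: "finite (verts H)" "r \<in> verts H" and S: "finite S"
  shows "dim2 (rooted_cuts H {r} S) \<le> card (verts H) - 1"
    and "card (verts H) - 1 \<le> dim2 (rooted_cuts H {r} S) + card S"
proof -
  have "dim2 (rooted_cuts H {r} S) \<le> card (verts H) - 1 \<and>
      card (verts H) - 1 \<le> dim2 (rooted_cuts H {r} S) + card S"
    using S
  proof (induction S)
    case empty
    show ?case using dim2_rooted_cuts_empty[OF H] by simp
  next
    case (insert e S)
    obtain a b where e: "ends H e = Upair a b" by (cases "ends H e")
    show ?case
      using insert dim2_kernel_le[OF cut_space_rooted_cuts[OF H(1), of "{r}" S] xor_linear_mem_neq[of a b]]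
      unfolding rooted_cuts_insert_edge[OF e] by auto
  qed
  then show "dim2 (rooted_cuts H {r} S) \<le> card (verts H) - 1"
    and "card (verts H) - 1 \<le> dim2 (rooted_cuts H {r} S) + card S" by auto
qed

lemma sym_adj_rel: "sym (adj_rel H S)"
  by (auto simp: sym_def adj_rel_def) (metis Upair_inject)

lemma equiv_conn_rel: "equiv (verts H) (conn_rel H S)"
  using sym_rtrancl[OF sym_adj_rel[of H S]]
  by (auto simp: equiv_def refl_on_def conn_rel_def sym_def trans_def)

lemma rooted_cut_closed:
  assumes "U \<in> rooted_cuts H R S" "(a, b) \<in> conn_rel H S"
  shows "a \<in> U \<longleftrightarrow> b \<in> U"
proof -
  have "(a, b) \<in> (adj_rel H S)\<^sup>*" using assms(2) by (auto simp: conn_rel_def)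
  then show ?thesis
    using assms(1) by (induction rule: rtrancl_induct) (auto simp: rooted_cuts_def adj_rel_def)
qed

text \<open>
  A rooted cut is an arbitrary union of components other than the one that contains the root.
\<close>

lemma dim2_rooted_cuts:
  assumes fin: "finite_mgraph H" and S: "S \<subseteq> edges H" and r: "r \<in> verts H"
  shows "dim2 (rooted_cuts H {r} S) = num_components H S - 1" and "num_components H S > 0"
proof -
  let ?R = "conn_rel H S" and ?V = "verts H"
  let ?P = "?V // ?R"
  have equiv: "equiv ?V ?R" by (rule equiv_conn_rel)
  have finP: "finite ?P"
    using fin by (intro finite_quotient) (auto simp: finite_mgraph_def conn_rel_def)
  have cr: "?R `` {r} \<in> ?P" using r by (rule quotientI)
  show "num_components H S > 0"
    using finP cr by (auto simp: num_components_def card_gt_0_iff)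
  have "bij_betw \<Union> (Pow (?P - {?R `` {r}})) (rooted_cuts H {r} S)"
  proof (rule bij_betw_byWitness[where f' = "\<lambda>U. {c \<in> ?P. c \<subseteq> U}"])
    show "\<forall>M\<in>Pow (?P - {?R `` {r}}). {c \<in> ?P. c \<subseteq> \<Union>M} = M"
    proof
      fix M assume M: "M \<in> Pow (?P - {?R `` {r}})"
      have "c \<in> M" if c: "c \<in> ?P" "c \<subseteq> \<Union>M" for c
      proof -
        obtain z where "z \<in> c" using c(1) in_quotient_imp_non_empty[OF equiv] by blast
        then obtain c' where "c' \<in> M" "z \<in> c'" using c by blast
        then show ?thesis using quotient_disj[OF equiv c(1), of c'] M \<open>z \<in> c\<close> by blast
      qed
      then show "{c \<in> ?P. c \<subseteq> \<Union>M} = M" using M by blast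
    qed
    show "\<forall>U\<in>rooted_cuts H {r} S. \<Union>{c \<in> ?P. c \<subseteq> U} = U"
    proof
      fix U assume U: "U \<in> rooted_cuts H {r} S"
      have "a \<in> \<Union>{c \<in> ?P. c \<subseteq> U}" if "a \<in> U" for a
      proof -
        have a: "a \<in> ?V" using U that by (auto simp: rooted_cuts_def)
        have "?R `` {a} \<subseteq> U" using rooted_cut_closed[OF U] that by auto
        then show ?thesis
          using quotientI[OF a, of ?R] equiv_class_self[OF equiv a] by blast
      qed
      then show "\<Union>{c \<in> ?P. c \<subseteq> U} = U" by blast
    qed
    show "\<Union> ` Pow (?P - {?R `` {r}}) \<subseteq> rooted_cuts H {r} S"
    proof (clarify, unfold rooted_cuts_def, intro CollectI conjI ballI allI impI)
      fix M assume M: "M \<subseteq> ?P - {?R `` {r}}"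
      have "r \<notin> c" if "c \<in> M" for c
        using M that quotient_disj[OF equiv _ cr, of c] equiv_class_self[OF equiv r] by blast
      then show "\<Union>M \<subseteq> ?V - {r}"
        using M in_quotient_imp_subset[OF equiv] by blast
      fix e a b assume e: "e \<in> S" "ends H e = Upair a b"
      have "a \<in> ?V" "b \<in> ?V"
        using fin e S by (auto simp: finite_mgraph_def) (metis insert_subset set_uprod_simps subsetD)+
      then have ab: "(a, b) \<in> ?R" "(b, a) \<in> ?R"
        using e equiv by (auto simp: conn_rel_def adj_rel_def intro!: r_into_rtrancl)
           (metis Upair_inject)
      have "b \<in> c" if "(a, b) \<in> ?R" "c \<in> ?P" "a \<in> c" for a b c
        using that equiv in_quotient_imp_closed by metis
      then show "a \<in> \<Union>M \<longleftrightarrow> b \<in> \<Union>M" using ab M by blast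
    qed
    show "(\<lambda>U. {c \<in> ?P. c \<subseteq> U}) ` rooted_cuts H {r} S \<subseteq> Pow (?P - {?R `` {r}})"
      using equiv_class_self[OF equiv r] by (auto simp: rooted_cuts_def)
  qed
  then have "card (rooted_cuts H {r} S) = card (Pow (?P - {?R `` {r}}))"
    using bij_betw_same_card by metis
  also have "\<dots> = 2 ^ (num_components H S - 1)"
    using finP cr by (simp add: card_Pow num_components_def)
  finally show "dim2 (rooted_cuts H {r} S) = num_components H S - 1" by (rule dim2_eqI)
qed

text \<open>
  In a connected graph the exponent of \<open>x - 1\<close> is the number of components minus one, which is the
  dimension of the rooted cut space. The power of \<open>y - 1\<close> on the left turns the nullity in the other
  exponent into that dimension plus the number of edges.
\<close>

theorem tutte_eq_cut_sum:
  fixes x y :: "'k :: comm_ring_1"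
  assumes fin: "finite_mgraph H" and conn: "connected_mgraph H" and r: "r \<in> verts H"
  shows "tutte H x y * (y - 1) ^ (card (verts H) - 1) =
    cut_sum ((x - 1) * (y - 1)) (y - 1) (edges H) (rooted_cuts H {r})"
  unfolding tutte_def cut_sum_def sum_distrib_right
proof (rule sum.cong[OF refl])
  fix S assume "S \<in> Pow (edges H)"
  then have S: "S \<subseteq> edges H" by simp
  have f: "finite (verts H)" "finite S"
    using fin S by (auto simp: finite_mgraph_def intro: finite_subset)
  define d where "d = dim2 (rooted_cuts H {r} S)"
  note bounds = dim2_rooted_cuts_bounds[OF f(1) r f(2), folded d_def]
  have V: "card (verts H) > 0" using f r by (auto simp: card_gt_0_iff)
  have k: "num_components H S = Suc d"
    using dim2_rooted_cuts[OF fin S r] by (simp add: d_def)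
  have "graph_rank H (edges H) - graph_rank H S = d"
    using conn bounds V by (simp add: graph_rank_def connected_mgraph_def k)
  moreover have "card S - graph_rank H S + (card (verts H) - 1) = d + card S"
    using bounds V by (simp add: graph_rank_def k)
  ultimately show "(x - 1) ^ (graph_rank H (edges H) - graph_rank H S) *
      (y - 1) ^ (card S - graph_rank H S) * (y - 1) ^ (card (verts H) - 1) =
      ((x - 1) * (y - 1)) ^ dim2 (rooted_cuts H {r} S) * (y - 1) ^ card S"
    by (simp add: mult.assoc power_add[symmetric] flip: d_def)
       (simp add: power_add power_mult_distrib mult.assoc)
qed

lemma connected_iff_rooted_cuts:
  assumes fin: "finite_mgraph H" and r: "r \<in> verts H"
  shows "connected_mgraph H \<longleftrightarrow> rooted_cuts H {r} (edges H) = {{}}"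
proof -
  have cs: "cut_space (rooted_cuts H {r} (edges H))"
    using fin by (intro cut_space_rooted_cuts) (simp add: finite_mgraph_def)
  have "connected_mgraph H \<longleftrightarrow> dim2 (rooted_cuts H {r} (edges H)) = 0"
    using dim2_rooted_cuts[OF fin order.refl r] by (auto simp: connected_mgraph_def)
  also have "\<dots> \<longleftrightarrow> card (rooted_cuts H {r} (edges H)) = 1"
    by (simp add: card_eq_dim2[OF cs])
  also have "\<dots> \<longleftrightarrow> rooted_cuts H {r} (edges H) = {{}}"
    using cs by (auto simp: card_1_singleton_iff cut_space_def)
  finally show ?thesis .
qed

section \<open>Identified vertices are additional roots\<close>

text \<open>
  A cut of the quotient that avoids the new vertex pulls back to a cut that avoids all of \<open>A\<close>, and
  conversely.
\<close>

lemma rooted_cuts_identify: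
  assumes A: "A \<subseteq> verts G" "A \<noteq> {}"
  shows "rooted_cuts (identify G A) {None} S = image Some ` rooted_cuts G A S"
proof -
  have verts: "verts (identify G A) - {None} = Some ` (verts G - A)"
    by (auto simp: identify_def merge_def)
  have edge: "(\<forall>a b. ends (identify G A) e = Upair a b \<longrightarrow> (a \<in> Some ` W \<longleftrightarrow> b \<in> Some ` W)) \<longleftrightarrow>
      (\<forall>a b. ends G e = Upair a b \<longrightarrow> (a \<in> W \<longleftrightarrow> b \<in> W))" if "W \<subseteq> verts G - A" for W e
  proof -
    obtain a b where ab: "ends G e = Upair a b" by (cases "ends G e")
    have m: "merge A c \<in> Some ` W \<longleftrightarrow> c \<in> W" for c
      using that by (auto simp: merge_def)
    have "ends (identify G A) e = Upair (merge A a) (merge A b)"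
      by (simp add: identify_def ab)
    then show ?thesis using m[of a] m[of b] ab by auto
  qed
  show ?thesis
  proof (intro Set.set_eqI iffI)
    fix U assume U: "U \<in> rooted_cuts (identify G A) {None} S"
    then have "U \<subseteq> Some ` (verts G - A)" by (simp add: rooted_cuts_def verts)
    then obtain W where W: "W \<subseteq> verts G - A" "U = Some ` W" by (auto simp: subset_image_iff)
    then have "W \<in> rooted_cuts G A S"
      using U edge[OF W(1)] unfolding rooted_cuts_def by auto
    then show "U \<in> image Some ` rooted_cuts G A S" using W by blast
  next
    fix U assume "U \<in> image Some ` rooted_cuts G A S"
    then obtain W where W: "W \<in> rooted_cuts G A S" "U = Some ` W" by blast
    then have W': "W \<subseteq> verts G - A" by (simp add: rooted_cuts_def)
    show "U \<in> rooted_cuts (identify G A) {None} S"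
      using W edge[OF W'] W' unfolding rooted_cuts_def verts by auto
  qed
qed

lemma inj_image_Some: "inj_on (image Some) M"
  by (intro inj_onI) (metis inj_Some inj_image_eq_iff)

lemma finite_identify: "finite_mgraph G \<Longrightarrow> finite_mgraph (identify G A)"
  unfolding finite_mgraph_def identify_def by (auto simp: uprod.set_map)

lemma None_in_identify: "A \<subseteq> verts G \<Longrightarrow> A \<noteq> {} \<Longrightarrow> None \<in> verts (identify G A)"
  by (force simp: identify_def merge_def)

lemma card_verts_identify:
  assumes "finite (verts G)" "A \<subseteq> verts G" "A \<noteq> {}"
  shows "card (verts (identify G A)) - 1 = card (verts G) - card A"
proof -
  have "verts (identify G A) = insert None (Some ` (verts G - A))"
    using assms by (force simp: identify_def merge_def)
  then show ?thesis
    using assms by (simp add: card_image card_Diff_subset finite_subset[OF assms(2)])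
qed

theorem tutte_identify_eq_cut_sum:
  fixes x y :: "'k :: comm_ring_1"
  assumes fin: "finite_mgraph G" and conn: "connected_mgraph G" and A: "A \<subseteq> verts G" "A \<noteq> {}"
  shows "tutte (identify G A) x y * (y - 1) ^ (card (verts G) - card A) =
    cut_sum ((x - 1) * (y - 1)) (y - 1) (edges G) (rooted_cuts G A)"
proof -
  let ?H = "identify G A"
  have fV: "finite (verts G)" using fin by (simp add: finite_mgraph_def)
  obtain a where a: "a \<in> A" using A by blast
  have "rooted_cuts G A (edges G) \<subseteq> rooted_cuts G {a} (edges G)"
    using a by (auto simp: rooted_cuts_def)
  moreover have "rooted_cuts G {a} (edges G) = {{}}"
    using connected_iff_rooted_cuts[OF fin, of a] a A conn by blast
  moreover have "{} \<in> rooted_cuts G A (edges G)" by (simp add: rooted_cuts_def)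
  ultimately have "rooted_cuts ?H {None} (edges ?H) = {{}}"
    by (simp add: rooted_cuts_identify[OF A]) (auto simp: identify_def)
  then have "connected_mgraph ?H"
    using connected_iff_rooted_cuts[OF finite_identify[OF fin] None_in_identify[OF A]] by blast
  then have "tutte ?H x y * (y - 1) ^ (card (verts ?H) - 1) =
      cut_sum ((x - 1) * (y - 1)) (y - 1) (edges ?H) (rooted_cuts ?H {None})"
    using finite_identify[OF fin] None_in_identify[OF A] by (intro tutte_eq_cut_sum)
  moreover have "dim2 (rooted_cuts ?H {None} S) = dim2 (rooted_cuts G A S)" for S
    unfolding rooted_cuts_identify[OF A] by (intro dim2_cong card_image inj_image_Some)
  moreover have "edges ?H = edges G" by (simp add: identify_def)
  ultimately show ?thesis by (simp only: cut_sum_def card_verts_identify[OF fV A])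
qed

section \<open>Rooted cuts of the fan, copy by copy\<close>

text \<open>
  The trace of a vertex set of the fan on the \<open>i\<close>-th copy. The hub \<open>None\<close> is left out, which
  is harmless because it is always the root.
\<close>

definition layer :: "(nat \<times> 'v) option set \<Rightarrow> nat \<Rightarrow> 'v set" where
  "layer U i = {a. Some (i, a) \<in> U}"

lemma edges_fan: "edges (fan n G v u w) = Inl ` ({1..n} \<times> edges G) \<union> Inr ` {1..<n}"
  by (simp add: fan_def identify_def copies_def Let_def)

lemma verts_fan:
  assumes "v \<in> verts G" "n \<ge> 1"
  shows "verts (fan n G v u w) = insert None (Some ` ({1..n} \<times> (verts G - {v})))"
  using assms by (force simp: fan_def identify_def copies_def Let_def merge_def)

lemma ends_fan_Inl:
  assumes "i \<in> {1..n}" "ends G e = Upair a b"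
  shows "ends (fan n G v u w) (Inl (i, e)) =
    Upair (if a = v then None else Some (i, a)) (if b = v then None else Some (i, b))"
  using assms by (simp add: fan_def identify_def copies_def Let_def merge_def)

lemma ends_fan_Inr:
  assumes "i \<in> {1..<n}" "u \<noteq> v" "w \<noteq> v"
  shows "ends (fan n G v u w) (Inr i) = Upair (Some (i, w)) (Some (Suc i, u))"
  using assms by (simp add: fan_def identify_def copies_def Let_def merge_def)

lemma finite_fan:
  assumes fin: "finite_mgraph G" and V: "{v, u, w} \<subseteq> verts G" "u \<noteq> v" "w \<noteq> v" and n: "n \<ge> 1"
  shows "finite_mgraph (fan n G v u w)"
  unfolding finite_mgraph_def
proof (intro conjI ballI)
  have v: "v \<in> verts G" using V by simp
  show "finite (verts (fan n G v u w))" "finite (edges (fan n G v u w))"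
    using fin by (simp_all add: verts_fan[OF v n] edges_fan finite_mgraph_def)
  fix f assume f: "f \<in> edges (fan n G v u w)"
  show "set_uprod (ends (fan n G v u w) f) \<subseteq> verts (fan n G v u w)"
  proof (cases f)
    case (Inl ie)
    then obtain i e where ie: "f = Inl (i, e)" "i \<in> {1..n}" "e \<in> edges G"
      using f by (auto simp: edges_fan)
    obtain a b where ab: "ends G e = Upair a b" by (cases "ends G e")
    then have "a \<in> verts G" "b \<in> verts G"
      using fin ie(3) by (force simp: finite_mgraph_def)+
    then show ?thesis
      using ie by (auto simp: ends_fan_Inl[OF ie(2) ab] verts_fan[OF v n])
  next
    case (Inr i)
    then have i: "i \<in> {1..<n}" using f by (auto simp: edges_fan)
    show ?thesis
      using i V by (auto simp: Inr ends_fan_Inr[OF i V(2,3)] verts_fan[OF v n])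
  qed
qed

lemma all_Upair_iff:
  "(\<forall>a b. Upair p q = Upair a b \<longrightarrow> (a \<in> U \<longleftrightarrow> b \<in> U)) \<longleftrightarrow> (p \<in> U \<longleftrightarrow> q \<in> U)"
  by auto

lemma ball_Inl_Pair_Inr:
  "(\<forall>f\<in>S. P f) \<longleftrightarrow> (\<forall>i e. Inl (i, e) \<in> S \<longrightarrow> P (Inl (i, e))) \<and> (\<forall>i. Inr i \<in> S \<longrightarrow> P (Inr i))"
proof (intro iffI ballI)
  fix f
  assume "(\<forall>i e. Inl (i, e) \<in> S \<longrightarrow> P (Inl (i, e))) \<and> (\<forall>i. Inr i \<in> S \<longrightarrow> P (Inr i))" "f \<in> S"
  then show "P f" by (cases f) auto
qed auto

lemma subset_Some_Times:
  "U \<subseteq> Some ` (I \<times> M) \<longleftrightarrow> U \<subseteq> Some ` (I \<times> UNIV) \<and> (\<forall>i\<in>I. layer U i \<subseteq> M)"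
proof (intro iffI conjI ballI subsetI)
  fix x assume U: "U \<subseteq> Some ` (I \<times> UNIV) \<and> (\<forall>i\<in>I. layer U i \<subseteq> M)" and x: "x \<in> U"
  then obtain i a where "x = Some (i, a)" "i \<in> I" by blast
  moreover have "a \<in> M" using U x calculation by (auto simp: layer_def)
  ultimately show "x \<in> Some ` (I \<times> M)" by blast
qed (auto simp: layer_def)

text \<open>
  Since the copies meet only in the hub, which is the root, a rooted cut of the fan is a family of
  rooted cuts of the copies, one for each copy. The only interaction is that an edge between
  consecutive copies forces its two ends onto the same side.
\<close>

lemma mem_rooted_cuts_fan:
  assumes v: "v \<in> verts G" and n: "n \<ge> 1" and ne: "u \<noteq> v" "w \<noteq> v"
    and S: "S \<subseteq> edges (fan n G v u w)"
  shows "U \<in> rooted_cuts (fan n G v u w) {None} S \<longleftrightarrow>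
    U \<subseteq> Some ` ({1..n} \<times> UNIV) \<and>
    (\<forall>i\<in>{1..n}. layer U i \<in> rooted_cuts G {v} {e. Inl (i, e) \<in> S}) \<and>
    (\<forall>i. Inr i \<in> S \<longrightarrow> (w \<in> layer U i \<longleftrightarrow> u \<in> layer U (Suc i)))"
proof -
  let ?F = "fan n G v u w"
  have "verts ?F - {None} = Some ` ({1..n} \<times> (verts G - {v}))"
    by (auto simp: verts_fan[OF v n])
  then have sub: "U \<subseteq> verts ?F - {None} \<longleftrightarrow>
      U \<subseteq> Some ` ({1..n} \<times> UNIV) \<and> (\<forall>i\<in>{1..n}. layer U i \<subseteq> verts G - {v})"
    by (simp only: subset_Some_Times[where M = "verts G - {v}"])
  have old: "(\<forall>a b. ends ?F (Inl (i, e)) = Upair a b \<longrightarrow> (a \<in> U \<longleftrightarrow> b \<in> U)) \<longleftrightarrow>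
      (\<forall>a b. ends G e = Upair a b \<longrightarrow> (a \<in> layer U i \<longleftrightarrow> b \<in> layer U i))"
    if i: "i \<in> {1..n}" and U: "U \<subseteq> verts ?F - {None}" for i e
  proof -
    obtain a b where ab: "ends G e = Upair a b" by (cases "ends G e")
    have "layer U i \<subseteq> verts G - {v}" using U i unfolding sub by (elim conjE bspec)
    moreover have "None \<notin> U" using U by blast
    ultimately have "(if c = v then None else Some (i, c)) \<in> U \<longleftrightarrow> c \<in> layer U i" for c
      by (auto simp: layer_def)
    then show ?thesis
      by (simp only: ends_fan_Inl[OF i ab] ab all_Upair_iff)
  qed
  have new: "(\<forall>a b. ends ?F (Inr i) = Upair a b \<longrightarrow> (a \<in> U \<longleftrightarrow> b \<in> U)) \<longleftrightarrow>
      (w \<in> layer U i \<longleftrightarrow> u \<in> layer U (Suc i))" if "Inr i \<in> S" for i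
  proof -
    have i: "i \<in> {1..<n}" using S that by (auto simp: edges_fan)
    show ?thesis unfolding ends_fan_Inr[OF i ne] layer_def by auto
  qed
  have range: "i \<in> {1..n}" if "Inl (i, e) \<in> S" for i e
    using S that by (auto simp: edges_fan)
  have edges: "(\<forall>f\<in>S. \<forall>a b. ends ?F f = Upair a b \<longrightarrow> (a \<in> U \<longleftrightarrow> b \<in> U)) \<longleftrightarrow>
      (\<forall>i\<in>{1..n}. \<forall>e\<in>{e. Inl (i, e) \<in> S}. \<forall>a b. ends G e = Upair a b \<longrightarrow> (a \<in> layer U i \<longleftrightarrow> b \<in> layer U i))
      \<and> (\<forall>i. Inr i \<in> S \<longrightarrow> (w \<in> layer U i \<longleftrightarrow> u \<in> layer U (Suc i)))"
    (is "?L \<longleftrightarrow> ?R") if U: "U \<subseteq> verts ?F - {None}"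
  proof -
    have "?L \<longleftrightarrow> (\<forall>i e. Inl (i, e) \<in> S \<longrightarrow> (\<forall>a b. ends ?F (Inl (i, e)) = Upair a b \<longrightarrow> (a \<in> U \<longleftrightarrow> b \<in> U)))
        \<and> (\<forall>i. Inr i \<in> S \<longrightarrow> (\<forall>a b. ends ?F (Inr i) = Upair a b \<longrightarrow> (a \<in> U \<longleftrightarrow> b \<in> U)))"
      (is "_ \<longleftrightarrow> ?A \<and> ?B")
      by (rule ball_Inl_Pair_Inr)
    moreover have "?A \<longleftrightarrow> (\<forall>i e. Inl (i, e) \<in> S \<longrightarrow>
        (\<forall>a b. ends G e = Upair a b \<longrightarrow> (a \<in> layer U i \<longleftrightarrow> b \<in> layer U i)))"
      using old[OF range U] by blast
    moreover have "?B \<longleftrightarrow> (\<forall>i. Inr i \<in> S \<longrightarrow> (w \<in> layer U i \<longleftrightarrow> u \<in> layer U (Suc i)))"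
      using new by blast
    moreover have "(\<forall>i e. Inl (i, e) \<in> S \<longrightarrow> Q i e) \<longleftrightarrow> (\<forall>i\<in>{1..n}. \<forall>e\<in>{e. Inl (i, e) \<in> S}. Q i e)" for Q
      using range by blast
    ultimately show ?thesis by (simp only:)
  qed
  show ?thesis
    unfolding rooted_cuts_def mem_Collect_eq
    by (subst conj_cong[OF refl edges], assumption) (simp only: sub ball_conj_distrib conj_assoc)
qed

lemma bij_betw_cuts_fan_1:
  assumes v: "v \<in> verts G" and ne: "u \<noteq> v" "w \<noteq> v" and S: "S \<subseteq> edges G"
  shows "bij_betw (\<lambda>U. layer U 1)
    {U \<in> rooted_cuts (fan 1 G v u w) {None} ((\<lambda>e. Inl (1, e)) ` S). layer U 1 \<inter> B = {}}
    (rooted_cuts G (insert v B) S)"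
proof (rule bij_betw_byWitness[where f' = "\<lambda>W. (\<lambda>a. Some (1, a)) ` W"])
  let ?S = "(\<lambda>e. Inl (1, e)) ` S :: (nat \<times> 'b + nat) set"
  have S': "?S \<subseteq> edges (fan 1 G v u w)" using S by (auto simp: edges_fan)
  note mem = mem_rooted_cuts_fan[OF v order.refl ne S', unfolded One_nat_def]
  have pre: "{e. Inl (Suc 0, e) \<in> (\<lambda>e. Inl (Suc 0, e)) ` S} = S" by auto
  have split: "W \<in> rooted_cuts G (insert v B) S \<longleftrightarrow> W \<in> rooted_cuts G {v} S \<and> W \<inter> B = {}" for W
    by (auto simp: rooted_cuts_def)
  have lay: "layer ((\<lambda>a. Some (1, a)) ` W) (Suc 0) = W" for W :: "'a set"
    by (auto simp: layer_def)
  show "\<forall>U\<in>{U \<in> rooted_cuts (fan 1 G v u w) {None} ?S. layer U 1 \<inter> B = {}}.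
      (\<lambda>a. Some (1, a)) ` layer U 1 = U"
    by (auto simp: mem layer_def)
  show "\<forall>W\<in>rooted_cuts G (insert v B) S. layer ((\<lambda>a. Some (1, a)) ` W) 1 = W"
    using lay by simp
  show "(\<lambda>U. layer U 1) ` {U \<in> rooted_cuts (fan 1 G v u w) {None} ?S. layer U 1 \<inter> B = {}}
      \<subseteq> rooted_cuts G (insert v B) S"
    by (auto simp: mem pre split)
  show "(`) (\<lambda>a. Some (1, a)) ` rooted_cuts G (insert v B) S
      \<subseteq> {U \<in> rooted_cuts (fan 1 G v u w) {None} ?S. layer U 1 \<inter> B = {}}"
    using lay by (auto simp: mem pre split)
qed

lemma layer_join: "(U - range (\<lambda>a. Some (j, a))) \<union> (\<lambda>a. Some (j, a)) ` layer U j = U"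
  by (auto simp: layer_def)

lemma layer_remove:
  assumes "U \<subseteq> Some ` ({1..n} \<times> UNIV)"
  shows "(U \<union> (\<lambda>a. Some (Suc n, a)) ` W) - range (\<lambda>a. Some (Suc n, a)) = U"
    and "layer (U \<union> (\<lambda>a. Some (Suc n, a)) ` W) (Suc n) = W"
proof -
  have *: "Some (Suc n, a) \<notin> U" for a using assms by auto
  then show "(U \<union> (\<lambda>a. Some (Suc n, a)) ` W) - range (\<lambda>a. Some (Suc n, a)) = U" by blast
  show "layer (U \<union> (\<lambda>a. Some (Suc n, a)) ` W) (Suc n) = W"
    using * by (auto simp: layer_def)
qed

lemma Some_Times_Suc:
  "Some ` ({1..Suc n} \<times> UNIV) = Some ` ({1..n} \<times> UNIV) \<union> range (\<lambda>a. Some (Suc n, a))"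
  by (auto simp: atLeastAtMostSuc_conv)

text \<open>
  Splitting off the last copy. The set \<open>B\<close> of additional roots in the last copy is \<open>{}\<close> for the fan
  itself and \<open>{w}\<close> for the fan whose last copy of \<open>w\<close> is identified with the hub; the set \<open>S3\<close>
  records whether the edge that leads to the last copy is present.
\<close>

lemma bij_betw_cuts_fan_Suc:
  assumes v: "v \<in> verts G" and n: "n \<ge> 1" and ne: "u \<noteq> v" "w \<noteq> v"
    and S1: "S1 \<subseteq> edges (fan n G v u w)" and S2: "S2 \<subseteq> edges G" and S3: "S3 \<subseteq> {Inr n}"
  shows "bij_betw (\<lambda>U. (U - range (\<lambda>a. Some (Suc n, a)), layer U (Suc n)))
    {U \<in> rooted_cuts (fan (Suc n) G v u w) {None} (S1 \<union> (\<lambda>e. Inl (Suc n, e)) ` S2 \<union> S3).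
       layer U (Suc n) \<inter> B = {}}
    {(U, W) \<in> rooted_cuts (fan n G v u w) {None} S1 \<times> rooted_cuts G (insert v B) S2.
       Inr n \<in> S3 \<longrightarrow> (w \<in> layer U n \<longleftrightarrow> u \<in> W)}"
proof -
  let ?new = "\<lambda>a. Some (Suc n, a)"
  let ?S = "S1 \<union> (\<lambda>e. Inl (Suc n, e)) ` S2 \<union> S3"
  let ?A = "{U \<in> rooted_cuts (fan (Suc n) G v u w) {None} ?S. layer U (Suc n) \<inter> B = {}}"
  let ?B = "{(U, W) \<in> rooted_cuts (fan n G v u w) {None} S1 \<times> rooted_cuts G (insert v B) S2.
       Inr n \<in> S3 \<longrightarrow> (w \<in> layer U n \<longleftrightarrow> u \<in> W)}"
  have S: "?S \<subseteq> edges (fan (Suc n) G v u w)"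
  proof (intro Un_least)
    have "edges (fan n G v u w) \<subseteq> edges (fan (Suc n) G v u w)" by (auto simp: edges_fan)
    then show "S1 \<subseteq> edges (fan (Suc n) G v u w)" using S1 by (rule order_trans[rotated])
    show "(\<lambda>e. Inl (Suc n, e)) ` S2 \<subseteq> edges (fan (Suc n) G v u w)"
      using S2 by (auto simp: edges_fan)
    have "{Inr n} \<subseteq> edges (fan (Suc n) G v u w)" using n by (simp add: edges_fan)
    then show "S3 \<subseteq> edges (fan (Suc n) G v u w)" using S3 by (rule order_trans[rotated])
  qed
  note mem1 = mem_rooted_cuts_fan[OF v n ne S1]
  note mem = mem_rooted_cuts_fan[OF v _ ne S]
  have split: "W \<in> rooted_cuts G (insert v B) S2 \<longleftrightarrow> W \<in> rooted_cuts G {v} S2 \<and> W \<inter> B = {}" for W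
    by (auto simp: rooted_cuts_def)
  have pre_old: "{e. Inl (i, e) \<in> ?S} = {e. Inl (i, e) \<in> S1}" if "i \<in> {1..n}" for i
  proof -
    have "Inl (i, e) \<notin> S3" for e using subsetD[OF S3, of "Inl (i, e)"] by blast
    moreover have "i \<noteq> Suc n" using that by simp
    ultimately show ?thesis by blast
  qed
  have "Inl (Suc n, e) \<notin> S1" for e
    using subsetD[OF S1, of "Inl (Suc n, e)"] by (auto simp: edges_fan)
  moreover have "Inl (Suc n, e) \<notin> S3" for e
    using subsetD[OF S3, of "Inl (Suc n, e)"] by blast
  ultimately have pre_new: "{e. Inl (Suc n, e) \<in> ?S} = S2" by blast
  have Inr_S: "Inr i \<in> ?S \<longleftrightarrow> Inr i \<in> S1 \<or> i = n \<and> Inr n \<in> S3" for i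
    using subsetD[OF S3, of "Inr i"] by blast
  have Inr_S1: "i \<in> {1..<n}" if "Inr i \<in> S1" for i
    using subsetD[OF S1 that] by (auto simp: edges_fan)
  have glue: "U \<in> ?A \<longleftrightarrow>
      U \<subseteq> Some ` ({1..Suc n} \<times> UNIV) \<and>
      (\<forall>i\<in>{1..n}. layer U i \<in> rooted_cuts G {v} {e. Inl (i, e) \<in> S1}) \<and>
      (\<forall>i. Inr i \<in> S1 \<longrightarrow> (w \<in> layer U i \<longleftrightarrow> u \<in> layer U (Suc i))) \<and>
      layer U (Suc n) \<in> rooted_cuts G (insert v B) S2 \<and>
      (Inr n \<in> S3 \<longrightarrow> (w \<in> layer U n \<longleftrightarrow> u \<in> layer U (Suc n)))" for U
  proof -
    have ins: "{1..Suc n} = insert (Suc n) {1..n}" by auto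
    have "(\<forall>i\<in>{1..Suc n}. layer U i \<in> rooted_cuts G {v} {e. Inl (i, e) \<in> ?S}) \<longleftrightarrow>
        layer U (Suc n) \<in> rooted_cuts G {v} S2 \<and>
        (\<forall>i\<in>{1..n}. layer U i \<in> rooted_cuts G {v} {e. Inl (i, e) \<in> ?S})"
      unfolding ins ball_simps(7) pre_new ..
    also have "\<dots> \<longleftrightarrow> layer U (Suc n) \<in> rooted_cuts G {v} S2 \<and>
        (\<forall>i\<in>{1..n}. layer U i \<in> rooted_cuts G {v} {e. Inl (i, e) \<in> S1})"
      by (intro conj_cong refl ball_cong) (simp only: pre_old)
    finally have old: "(\<forall>i\<in>{1..Suc n}. layer U i \<in> rooted_cuts G {v} {e. Inl (i, e) \<in> ?S}) \<longleftrightarrow> \<dots>" .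
    have "(\<forall>i. Inr i \<in> ?S \<longrightarrow> Q i) \<longleftrightarrow> (\<forall>i. Inr i \<in> S1 \<longrightarrow> Q i) \<and> (Inr n \<in> S3 \<longrightarrow> Q n)" for Q
      unfolding Inr_S by blast
    then show ?thesis
      unfolding mem_Collect_eq mem[OF le_SucI[OF n]] old split by (simp only: conj_ac)
  qed
  have lay_old: "layer (U - range ?new) i = layer U i" "layer (U \<union> ?new ` W) i = layer U i"
    if "i \<in> {1..n}" for i U and W :: "'a set"
    using that by (auto simp: layer_def)
  show ?thesis
  proof (rule bij_betw_byWitness[where f' = "\<lambda>(U, W). U \<union> ?new ` W"])
    show "\<forall>U\<in>?A. (case (U - range ?new, layer U (Suc n)) of (U, W) \<Rightarrow> U \<union> ?new ` W) = U"
      by (simp only: prod.case layer_join) blast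
    show "\<forall>UW\<in>?B. ((case UW of (U, W) \<Rightarrow> U \<union> ?new ` W) - range ?new,
        layer (case UW of (U, W) \<Rightarrow> U \<union> ?new ` W) (Suc n)) = UW"
    proof
      fix UW assume "UW \<in> ?B"
      then obtain U W where UW: "UW = (U, W)" "U \<in> rooted_cuts (fan n G v u w) {None} S1" by blast
      then have "U \<subseteq> Some ` ({1..n} \<times> UNIV)" unfolding mem1 by blast
      then show "((case UW of (U, W) \<Rightarrow> U \<union> ?new ` W) - range ?new,
        layer (case UW of (U, W) \<Rightarrow> U \<union> ?new ` W) (Suc n)) = UW"
        unfolding UW(1) prod.case by (simp only: layer_remove)
    qed
    show "(\<lambda>U. (U - range ?new, layer U (Suc n))) ` ?A \<subseteq> ?B"
    proof (rule image_subsetI)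
      fix U assume "U \<in> ?A"
      note U = this[unfolded glue]
      have "U - range ?new \<in> rooted_cuts (fan n G v u w) {None} S1"
        unfolding mem1
      proof (intro conjI ballI allI impI)
        show "U - range ?new \<subseteq> Some ` ({1..n} \<times> UNIV)"
          using U unfolding Some_Times_Suc by blast
      next
        fix i assume i: "i \<in> {1..n}"
        then show "layer (U - range ?new) i \<in> rooted_cuts G {v} {e. Inl (i, e) \<in> S1}"
          unfolding lay_old(1)[OF i] using U by blast
      next
        fix i assume i: "Inr i \<in> S1"
        then have "i \<in> {1..n}" "Suc i \<in> {1..n}" using Inr_S1 by force+
        then show "w \<in> layer (U - range ?new) i \<longleftrightarrow> u \<in> layer (U - range ?new) (Suc i)"
          unfolding lay_old(1)[OF \<open>i \<in> _\<close>] lay_old(1)[OF \<open>Suc i \<in> _\<close>] using U i by blast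
      qed
      moreover have "layer (U - range ?new) n = layer U n"
        using lay_old(1)[of n] n by simp
      ultimately show "(U - range ?new, layer U (Suc n)) \<in> ?B" using U by blast
    qed
    show "(\<lambda>(U, W). U \<union> ?new ` W) ` ?B \<subseteq> ?A"
    proof (rule image_subsetI)
      fix UW assume "UW \<in> ?B"
      then obtain U W where UW: "UW = (U, W)"
        and U: "U \<in> rooted_cuts (fan n G v u w) {None} S1"
        and W: "W \<in> rooted_cuts G (insert v B) S2"
        and uw: "Inr n \<in> S3 \<longrightarrow> (w \<in> layer U n \<longleftrightarrow> u \<in> W)" by blast
      note U = U[unfolded mem1]
      have new: "layer (U \<union> ?new ` W) (Suc n) = W"
        using U by (intro layer_remove) blast
      show "(case UW of (U, W) \<Rightarrow> U \<union> ?new ` W) \<in> ?A"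
        unfolding UW prod.case glue
      proof (intro conjI ballI allI impI)
        show "U \<union> ?new ` W \<subseteq> Some ` ({1..Suc n} \<times> UNIV)"
          using U unfolding Some_Times_Suc by blast
        show "layer (U \<union> ?new ` W) (Suc n) \<in> rooted_cuts G (insert v B) S2"
          using W new by simp
      next
        fix i assume i: "i \<in> {1..n}"
        then show "layer (U \<union> ?new ` W) i \<in> rooted_cuts G {v} {e. Inl (i, e) \<in> S1}"
          unfolding lay_old(2)[OF i] using U by blast
      next
        fix i assume i: "Inr i \<in> S1"
        then have "i \<in> {1..n}" "Suc i \<in> {1..n}" using Inr_S1 by force+
        then show "w \<in> layer (U \<union> ?new ` W) i \<longleftrightarrow> u \<in> layer (U \<union> ?new ` W) (Suc i)"
          unfolding lay_old(2)[OF \<open>i \<in> _\<close>] lay_old(2)[OF \<open>Suc i \<in> _\<close>] using U i by blast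
      next
        assume "Inr n \<in> S3"
        then show "w \<in> layer (U \<union> ?new ` W) n \<longleftrightarrow> u \<in> layer (U \<union> ?new ` W) (Suc n)"
          using uw new lay_old(2)[of n] n by simp
      qed
    qed
  qed
qed

section \<open>The transfer recurrence\<close>

lemma sum_Pow_Un_disjoint:
  assumes "finite A" "finite B" "A \<inter> B = {}"
  shows "(\<Sum>S\<in>Pow (A \<union> B). f S) = (\<Sum>S\<in>Pow A. \<Sum>R\<in>Pow B. f (S \<union> R))"
proof -
  have "(\<Sum>S\<in>Pow A. \<Sum>R\<in>Pow B. f (S \<union> R)) = (\<Sum>(S, R)\<in>Pow A \<times> Pow B. f (S \<union> R))"
    by (rule sum.cartesian_product)
  also have "\<dots> = (\<Sum>S\<in>Pow (A \<union> B). f S)"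
    by (rule sum.reindex_bij_witness[where j = "\<lambda>(S, R). S \<union> R" and i = "\<lambda>S. (S \<inter> A, S \<inter> B)"])
       (use assms(3) in auto)
  finally show ?thesis by simp
qed

lemma sum_Pow_image:
  assumes "inj g"
  shows "(\<Sum>S\<in>Pow (g ` A). f S) = (\<Sum>S\<in>Pow A. f (g ` S))"
proof -
  have "Pow (g ` A) = image g ` Pow A" by (simp add: image_Pow_surj)
  moreover have "inj_on (image g) (Pow A)"
    using assms by (meson inj_image_eq_iff inj_onI)
  ultimately show ?thesis by (simp add: sum.reindex)
qed

text \<open>
  With \<open>B = {w}\<close> these are the rooted cuts of the fan with the last copy of \<open>w\<close> identified with the
  hub. This quotient is represented only by its cuts and never formed as a graph.
\<close>

definition fan_cuts ::
  "nat \<Rightarrow> ('v, 'e) mgraph \<Rightarrow> 'v \<Rightarrow> 'v \<Rightarrow> 'v \<Rightarrow> 'v set \<Rightarrow> (nat \<times> 'e + nat) set \<Rightarrow> (nat \<times> 'v) option set set"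
  where "fan_cuts n G v u w B S =
    {U \<in> rooted_cuts (fan n G v u w) {None} S. layer U n \<inter> B = {}}"

lemma cut_sum_fan_1:
  assumes v: "v \<in> verts G" and ne: "u \<noteq> v" "w \<noteq> v"
  shows "cut_sum q t (edges (fan 1 G v u w)) (fan_cuts 1 G v u w B) =
    cut_sum q t (edges G) (rooted_cuts G (insert v B))"
proof -
  have inj: "inj (\<lambda>e. Inl (1, e) :: nat \<times> 'b + nat)" by (simp add: inj_def)
  have E: "edges (fan 1 G v u w) = (\<lambda>e. Inl (1, e)) ` edges G" by (auto simp: edges_fan)
  have card: "card ((\<lambda>e. Inl (Suc 0, e) :: nat \<times> 'b + nat) ` S) = card S" for S
    by (rule card_image) (simp add: inj_on_def)
  have "dim2 (fan_cuts 1 G v u w B ((\<lambda>e. Inl (1, e)) ` S)) = dim2 (rooted_cuts G (insert v B) S)"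
    if "S \<subseteq> edges G" for S
    unfolding fan_cuts_def
    by (intro dim2_cong bij_betw_same_card[OF bij_betw_cuts_fan_1] assms that)
  then show ?thesis
    unfolding cut_sum_def E sum_Pow_image[OF inj]
    by (intro sum.cong refl) (simp add: card)
qed

lemma dim2_Times:
  assumes "cut_space C" "cut_space D"
  shows "dim2 (C \<times> D) = dim2 C + dim2 D"
  by (rule dim2_eqI)
     (simp only: card_cartesian_product card_eq_dim2[OF assms(1)] card_eq_dim2[OF assms(2)] power_add)

text \<open>
  Each edge set of the longer fan consists of an edge set of the shorter fan, one of the new copy,
  and possibly the edge between them. Without that edge the cut spaces multiply; with it they are
  glued along the linear condition of \<open>weight_product_agree\<close>.
\<close>

lemma cut_sum_fan_Suc:
  fixes q t :: "'k :: field"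
  assumes fin: "finite_mgraph G" and V: "{v, u, w} \<subseteq> verts G" "u \<noteq> v" "w \<noteq> v" and n: "n \<ge> 1"
    and q: "q \<noteq> 0" "q \<noteq> 1"
  defines "Z \<equiv> \<lambda>n B. cut_sum q t (edges (fan n G v u w)) (fan_cuts n G v u w B)"
    and "Y \<equiv> \<lambda>R. cut_sum q t (edges G) (rooted_cuts G R)"
  shows "Z (Suc n) B =
    (1 + t / q) * (Z n {} * Y (insert v B)) +
    t / (q * (q - 1)) * ((q * Z n {w} - Z n {}) * (q * Y (insert u (insert v B)) - Y (insert v B)))"
proof -
  have v: "v \<in> verts G" using V by simp
  let ?E = "edges (fan n G v u w)" and ?g = "\<lambda>e. Inl (Suc n, e) :: nat \<times> 'b + nat"
  have inj: "inj ?g" by (simp add: inj_def)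
  have finE: "finite ?E" "finite (edges G)"
    using fin by (simp_all add: edges_fan finite_mgraph_def)
  have E: "edges (fan (Suc n) G v u w) = ?E \<union> ?g ` edges G \<union> {Inr n}"
    using n by (auto simp: edges_fan atLeastAtMostSuc_conv atLeastLessThanSuc)
  have disj: "?E \<inter> ?g ` edges G = {}" "(?E \<union> ?g ` edges G) \<inter> {Inr n} = {}"
    by (auto simp: edges_fan)
  have fing: "finite (?g ` edges G)" "finite (?E \<union> ?g ` edges G)" using finE by simp_all
  have sum: "(\<Sum>S\<in>Pow (edges (fan (Suc n) G v u w)). f S) =
      (\<Sum>S1\<in>Pow ?E. \<Sum>S2\<in>Pow (edges G). f (S1 \<union> ?g ` S2) + f (S1 \<union> ?g ` S2 \<union> {Inr n}))"
    for f :: "_ \<Rightarrow> 'k"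
  proof -
    have "(\<Sum>S\<in>Pow (edges (fan (Suc n) G v u w)). f S) =
        (\<Sum>S\<in>Pow (?E \<union> ?g ` edges G). \<Sum>R\<in>Pow {Inr n}. f (S \<union> R))"
      unfolding E by (rule sum_Pow_Un_disjoint[OF fing(2) _ disj(2)]) simp
    also have "\<dots> = (\<Sum>S\<in>Pow (?E \<union> ?g ` edges G). f S + f (S \<union> {Inr n}))"
      by (simp add: Pow_insert add.commute)
    also have "\<dots> = (\<Sum>S1\<in>Pow ?E. \<Sum>R\<in>Pow (?g ` edges G). f (S1 \<union> R) + f (S1 \<union> R \<union> {Inr n}))"
      by (rule sum_Pow_Un_disjoint[OF finE(1) fing(1) disj(1)])
    finally show ?thesis unfolding sum_Pow_image[OF inj] .
  qed
  let ?C = "\<lambda>B. fan_cuts n G v u w B" and ?D = "\<lambda>R. rooted_cuts G R"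
  define a where "a = (\<lambda>S. q ^ dim2 (?C {} S) * t ^ card S)"
  define a' where "a' = (\<lambda>S. q ^ dim2 (?C {w} S) * t ^ card S)"
  define b where "b = (\<lambda>S. q ^ dim2 (?D (insert v B) S) * t ^ card S)"
  define b' where "b' = (\<lambda>S. q ^ dim2 (?D (insert u (insert v B)) S) * t ^ card S)"
  have summand:
    "q ^ dim2 (fan_cuts (Suc n) G v u w B (S1 \<union> ?g ` S2)) * t ^ card (S1 \<union> ?g ` S2) +
     q ^ dim2 (fan_cuts (Suc n) G v u w B (S1 \<union> ?g ` S2 \<union> {Inr n})) * t ^ card (S1 \<union> ?g ` S2 \<union> {Inr n}) =
     (1 + t / q) * (a S1 * b S2) + t / (q * (q - 1)) * ((q * a' S1 - a S1) * (q * b' S2 - b S2))"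
    if S1: "S1 \<subseteq> ?E" and S2: "S2 \<subseteq> edges G" for S1 S2
  proof -
    have f: "finite S1" "finite S2" using S1 S2 finE finite_subset by blast+
    have card: "card (S1 \<union> ?g ` S2) = card S1 + card S2"
      using f disj(1) S1 S2 card_image[OF inj_on_subset[OF inj], of S2]
      by (subst card_Un_disjoint) auto
    have "Inr n \<notin> S1 \<union> ?g ` S2" using S1 by (auto simp: edges_fan)
    then have card': "card (S1 \<union> ?g ` S2 \<union> {Inr n}) = Suc (card S1 + card S2)"
      using f card by simp
    have C: "cut_space (?C {} S1)"
      using cut_space_rooted_cuts[of "fan n G v u w" "{None}" S1] finite_fan[OF fin V n]
      by (simp add: fan_cuts_def finite_mgraph_def)
    have D: "cut_space (?D (insert v B) S2)"
      using fin by (intro cut_space_rooted_cuts) (simp add: finite_mgraph_def)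
    have C': "{U \<in> ?C {} S1. \<not> Some (n, w) \<in> U} = ?C {w} S1"
      by (auto simp: fan_cuts_def layer_def)
    have D': "{W \<in> ?D (insert v B) S2. \<not> u \<in> W} = ?D (insert u (insert v B)) S2"
      by (rule rooted_cuts_insert_root[symmetric])
    have glue: "dim2 (fan_cuts (Suc n) G v u w B (S1 \<union> ?g ` S2 \<union> S3)) =
        dim2 {(U, W) \<in> ?C {} S1 \<times> ?D (insert v B) S2. Inr n \<in> S3 \<longrightarrow> (Some (n, w) \<in> U \<longleftrightarrow> u \<in> W)}"
      if "S3 \<subseteq> {Inr n}" for S3
      using bij_betw_same_card[OF bij_betw_cuts_fan_Suc[OF v n V(2,3) S1 S2 that, of B]]
      by (intro dim2_cong) (simp add: fan_cuts_def layer_def)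
    have "dim2 (fan_cuts (Suc n) G v u w B (S1 \<union> ?g ` S2)) =
        dim2 (?C {} S1 \<times> ?D (insert v B) S2)"
      using glue[of "{}"] by simp
    then have deleted: "q ^ dim2 (fan_cuts (Suc n) G v u w B (S1 \<union> ?g ` S2)) =
        q ^ dim2 (?C {} S1) * q ^ dim2 (?D (insert v B) S2)"
      by (simp add: dim2_Times[OF C D] power_add)
    have "dim2 (fan_cuts (Suc n) G v u w B (S1 \<union> ?g ` S2 \<union> {Inr n})) =
        dim2 {(U, W) \<in> ?C {} S1 \<times> ?D (insert v B) S2. Some (n, w) \<in> U \<longleftrightarrow> u \<in> W}"
      using glue[of "{Inr n}"] by simp
    then have present: "q ^ dim2 (fan_cuts (Suc n) G v u w B (S1 \<union> ?g ` S2 \<union> {Inr n})) =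
        q ^ dim2 (?C {} S1) * q ^ dim2 (?D (insert v B) S2) / q +
        (q * q ^ dim2 (?C {w} S1) - q ^ dim2 (?C {} S1)) *
        (q * q ^ dim2 (?D (insert u (insert v B)) S2) - q ^ dim2 (?D (insert v B) S2)) / (q * (q - 1))"
      using weight_product_agree[OF C xor_linear_mem D xor_linear_mem q, of "Some (n, w)" u]
      by (simp only: C' D')
    show ?thesis
      unfolding deleted present card card' a_def a'_def b_def b'_def
      using q by (simp add: divide_simps power_add) (simp add: algebra_simps)
  qed
  have "Z (Suc n) B = (\<Sum>S1\<in>Pow ?E. \<Sum>S2\<in>Pow (edges G).
      (1 + t / q) * (a S1 * b S2) + t / (q * (q - 1)) * ((q * a' S1 - a S1) * (q * b' S2 - b S2)))"
    unfolding Z_def cut_sum_def sum by (intro sum.cong refl summand) auto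
  also have "\<dots> = (1 + t / q) * (sum a (Pow ?E) * sum b (Pow (edges G))) +
      t / (q * (q - 1)) * ((\<Sum>S\<in>Pow ?E. q * a' S - a S) * (\<Sum>S\<in>Pow (edges G). q * b' S - b S))"
    by (simp only: sum.distrib sum_distrib_left[symmetric] sum_product)
  also have "\<dots> = (1 + t / q) * (Z n {} * Y (insert v B)) +
    t / (q * (q - 1)) * ((q * Z n {w} - Z n {}) * (q * Y (insert u (insert v B)) - Y (insert v B)))"
    by (simp only: sum_subtractf sum_distrib_left[symmetric] Z_def Y_def cut_sum_def a_def a'_def b_def b'_def)
  finally show ?thesis .
qed

lemma tutte_fan_eq_cut_sum:
  fixes x y :: "'k :: comm_ring_1"
  assumes fin: "finite_mgraph G" and conn: "connected_mgraph G"
    and V: "{v, u, w} \<subseteq> verts G" "u \<noteq> v" "w \<noteq> v" and n: "n \<ge> 1"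
  shows "tutte (fan n G v u w) x y * (y - 1) ^ (n * (card (verts G) - 1)) =
    cut_sum ((x - 1) * (y - 1)) (y - 1) (edges (fan n G v u w)) (fan_cuts n G v u w {})"
proof -
  let ?F = "fan n G v u w"
  have v: "v \<in> verts G" using V by simp
  have r: "None \<in> verts ?F" by (simp add: verts_fan[OF v n])
  have finF: "finite_mgraph ?F" by (rule finite_fan[OF fin V n])
  have G: "rooted_cuts G {v} (edges G) = {{}}"
    using connected_iff_rooted_cuts[OF fin v] conn by blast
  have copy: "{e. Inl (i, e) \<in> edges ?F} = edges G" if "i \<in> {1..n}" for i
    using that by (auto simp: edges_fan)
  have "U = {}" if "U \<in> rooted_cuts ?F {None} (edges ?F)" for U
  proof -
    note U = that[unfolded mem_rooted_cuts_fan[OF v n V(2,3) order.refl]]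
    have "layer U i = {}" if "i \<in> {1..n}" for i
    proof -
      have "layer U i \<in> rooted_cuts G {v} (edges G)" using U that copy[OF that] by metis
      then show ?thesis by (simp add: G)
    qed
    then have "U \<subseteq> Some ` ({1..n} \<times> {})" using U subset_Some_Times[of U "{1..n}" "{}"] by blast
    then show ?thesis by simp
  qed
  moreover have "{} \<in> rooted_cuts ?F {None} (edges ?F)" by (simp add: rooted_cuts_def)
  ultimately have "connected_mgraph ?F"
    using connected_iff_rooted_cuts[OF finF r] by blast
  moreover have "card (verts ?F) - 1 = n * (card (verts G) - 1)"
    using v fin by (simp add: verts_fan[OF v n] card_image card_cartesian_product finite_mgraph_def)
  moreover have "fan_cuts n G v u w {} = rooted_cuts ?F {None}"
    by (simp add: fan_cuts_def fun_eq_iff)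
  ultimately show ?thesis using tutte_eq_cut_sum[OF finF _ r, of x y] by simp
qed

section \<open>Second-order recurrences\<close>

text \<open>
  The Lucas sequence \<open>U\<close> with parameters \<open>p\<close> and \<open>- r\<close>.
\<close>

fun lucas_U :: "'a::comm_ring_1 \<Rightarrow> 'a \<Rightarrow> nat \<Rightarrow> 'a" where
  "lucas_U p r 0 = 0"
| "lucas_U p r (Suc 0) = 1"
| "lucas_U p r (Suc (Suc n)) = p * lucas_U p r (Suc n) + r * lucas_U p r n"

lemma recurrence_eq_lucas_U:
  assumes "\<And>n. n \<ge> 1 \<Longrightarrow> f (Suc (Suc n)) = p * f (Suc n) + r * f n"
  shows "f (Suc n) = f 1 * lucas_U p r (Suc n) + (f 2 - p * f 1) * lucas_U p r n"
proof (induction n rule: less_induct)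
  case (less n)
  consider "n = 0" | "n = Suc 0" | k where "n = Suc (Suc k)" by (metis not0_implies_Suc)
  then show ?case
  proof cases
    case 3
    have "f (Suc n) = p * f (Suc (Suc k)) + r * f (Suc k)"
      using assms[of "Suc k"] 3 by simp
    then show ?thesis
      using less[of "Suc k"] less[of k] 3 by (simp add: algebra_simps)
  qed (simp_all add: algebra_simps numeral_2_eq_2)
qed

lemma lucas_U_eq_quotient:
  fixes a b :: "'a :: field"
  assumes "a \<noteq> b" "p = a + b" "r = - (a * b)"
  shows "lucas_U p r n = (a ^ n - b ^ n) / (a - b)"
proof (induction n rule: less_induct)
  case (less n)
  consider "n = 0" | "n = Suc 0" | k where "n = Suc (Suc k)" by (metis not0_implies_Suc)
  then show ?case
  proof cases
    case 3
    have "lucas_U p r n = p * ((a ^ Suc k - b ^ Suc k) / (a - b)) + r * ((a ^ k - b ^ k) / (a - b))"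
      using less[of "Suc k"] less[of k] 3 by simp
    also have "\<dots> = (a ^ n - b ^ n) / (a - b)"
      unfolding 3 assms(2,3) times_divide_eq_right add_divide_distrib[symmetric]
      by (simp add: algebra_simps)
    finally show ?thesis .
  qed (use assms(1) in simp_all)
qed

text \<open>
  Pascal's rule, coefficient by coefficient. Summing up to \<open>m\<close> instead of \<open>m div 2\<close> only adds terms
  with vanishing binomial coefficients and keeps the index shift uniform.
\<close>

lemma lucas_U_Suc_eq_sum:
  "lucas_U p r (Suc m) = (\<Sum>j\<le>m. of_nat ((m - j) choose j) * p ^ (m - 2 * j) * r ^ j)"
proof (induction m rule: less_induct)
  case (less m)
  let ?s = "\<lambda>m j. of_nat ((m - j) choose j) * p ^ (m - 2 * j) * r ^ j"
  consider "m = 0" | "m = Suc 0" | k where "m = Suc (Suc k)" by (metis not0_implies_Suc)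
  then show ?case
  proof cases
    case 3
    have pascal: "?s m (Suc j) = r * ?s k j + p * ?s (Suc k) (Suc j)" if "j \<le> k" for j
    proof (cases "2 * j < k")
      case True
      then have "k - 2 * j = Suc (Suc k - 2 * Suc j)" by simp
      moreover have "Suc k - j = Suc (k - j)" using that by simp
      ultimately show ?thesis by (simp add: 3 algebra_simps)
    next
      case False
      then have "k - j < Suc j" by simp
      moreover have "Suc k - j = Suc (k - j)" using that by simp
      ultimately show ?thesis by (simp add: 3 algebra_simps binomial_eq_0)
    qed
    have "(\<Sum>j\<le>k. ?s m (Suc j)) = (\<Sum>j\<le>k. r * ?s k j + p * ?s (Suc k) (Suc j))"
      by (intro sum.cong refl pascal) simp
    then have shifted: "(\<Sum>j\<le>k. ?s m (Suc j)) = r * (\<Sum>j\<le>k. ?s k j) + p * (\<Sum>j\<le>k. ?s (Suc k) (Suc j))"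
      by (simp only: sum.distrib sum_distrib_left)
    have "lucas_U p r (Suc m) = p * (\<Sum>j\<le>Suc k. ?s (Suc k) j) + r * (\<Sum>j\<le>k. ?s k j)"
      using less[of "Suc k"] less[of k] 3 by simp
    also have "(\<Sum>j\<le>Suc k. ?s (Suc k) j) = p ^ Suc k + (\<Sum>j\<le>k. ?s (Suc k) (Suc j))"
      by (subst sum.atMost_Suc_shift) simp
    also have "p * (p ^ Suc k + (\<Sum>j\<le>k. ?s (Suc k) (Suc j))) + r * (\<Sum>j\<le>k. ?s k j) =
        p ^ m + (\<Sum>j\<le>k. ?s m (Suc j))"
      unfolding shifted by (simp add: 3 algebra_simps del: binomial_Suc_Suc)
    also have "\<dots> = p ^ m + (\<Sum>j\<le>Suc k. ?s m (Suc j))"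
      by (simp add: 3)
    also have "\<dots> = (\<Sum>j\<le>m. ?s m j)"
      unfolding 3 by (subst (2) sum.atMost_Suc_shift) simp
    finally show ?thesis .
  qed (simp_all)
qed

lemma lucas_U_eq_sum:
  "lucas_U p r n =
    (\<Sum>j\<in>{j. int j \<le> (int n - 1) div 2}. of_nat ((n - j - 1) choose j) * p ^ (n - 2 * j - 1) * r ^ j)"
proof (cases n)
  case 0
  then show ?thesis by simp
next
  case (Suc m)
  have "{j. int j \<le> (int n - 1) div 2} = {j. 2 * j \<le> m}" using Suc by auto
  moreover have "(\<Sum>j\<le>m. of_nat ((m - j) choose j) * p ^ (m - 2 * j) * r ^ j) =
      (\<Sum>j\<in>{j. 2 * j \<le> m}. of_nat ((m - j) choose j) * p ^ (m - 2 * j) * r ^ j)"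
  proof (rule sum.mono_neutral_right)
    show "\<forall>j\<in>{..m} - {j. 2 * j \<le> m}. of_nat ((m - j) choose j) * p ^ (m - 2 * j) * r ^ j = 0"
    proof
      fix j assume "j \<in> {..m} - {j. 2 * j \<le> m}"
      then have "m - j < j" by auto
      then show "of_nat ((m - j) choose j) * p ^ (m - 2 * j) * r ^ j = 0" by (simp add: binomial_eq_0)
    qed
  qed auto
  moreover have "n - j - 1 = m - j" "n - 2 * j - 1 = m - 2 * j" for j using Suc by auto
  ultimately show ?thesis using Suc lucas_U_Suc_eq_sum[of p r m] by simp
qed

text \<open>
  The recurrence of \<open>cut_sum_fan_Suc\<close> after the powers of \<open>t = y - 1\<close> that normalise the Tutte
  polynomials have been inserted: \<open>t * N\<close> and \<open>t * P\<close> belong to the fan and to the new copy, \<open>N\<close> and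
  \<open>P\<close> to their quotients, which have one vertex less. Here \<open>h\<close> is \<open>x - 1\<close>.
\<close>

lemma transfer_algebra:
  fixes h t N P T0 Tu \<tau> \<sigma> q :: "'k :: field"
  assumes "h \<noteq> 0" "t \<noteq> 0" "q = h * t" "q \<noteq> 1"
  shows "(1 + t / q) * (\<tau> * (t * N) * (T0 * (t * P))) +
      t / (q * (q - 1)) * ((q * (\<sigma> * N) - \<tau> * (t * N)) * (q * (Tu * P) - T0 * (t * P))) =
    (((q + t - 1) * T0 - Tu) / (q - 1) * \<tau> + (h * Tu - T0) / (q - 1) * \<sigma>) * ((t * N) * (t * P))"
proof -
  have q: "q - 1 \<noteq> 0" "q \<noteq> 0" using assms by auto
  have "1 + t / q = (h + 1) / h" using assms by (simp add: field_simps)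
  moreover have "t / (q * (q - 1)) = 1 / (h * (q - 1))" using assms by simp
  moreover have "q * (\<sigma> * N) - \<tau> * (t * N) = (h * \<sigma> - \<tau>) * (t * N)"
    "q * (Tu * P) - T0 * (t * P) = (h * Tu - T0) * (t * P)"
    using assms by (simp_all add: algebra_simps)
  moreover have "c * (\<tau> * a * (T0 * b)) + 1 / d * ((M * a) * (R * b)) = (c * T0 * \<tau> + M * R / d) * (a * b)"
    for c d M R a b :: 'k by (simp add: algebra_simps)
  ultimately have "(1 + t / q) * (\<tau> * (t * N) * (T0 * (t * P))) +
      t / (q * (q - 1)) * ((q * (\<sigma> * N) - \<tau> * (t * N)) * (q * (Tu * P) - T0 * (t * P))) =
      ((h + 1) / h * T0 * \<tau> + (h * \<sigma> - \<tau>) * (h * Tu - T0) / (h * (q - 1))) * ((t * N) * (t * P))"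
    by (simp only:)
  moreover have "(h + 1) / h * T0 * \<tau> + (h * \<sigma> - \<tau>) * (h * Tu - T0) / (h * (q - 1)) =
      ((q + t - 1) * T0 - Tu) / (q - 1) * \<tau> + (h * Tu - T0) / (q - 1) * \<sigma>"
    using q(1) assms(1) by (simp add: divide_simps) (simp add: assms(3) algebra_simps)
  ultimately show ?thesis by simp
qed

text \<open>
  Appending a copy acts linearly on the pair formed by the Tutte polynomial of the fan and
  \<open>\<sigma> n\<close>, the Tutte polynomial of the fan with the last copy of \<open>w\<close> identified with the hub. It is
  an abstract sequence here because this quotient is known only through its cuts. The
  matrix of this action is obtained from the coefficients \<open>A\<close>, \<open>B\<close>, \<open>C\<close>, \<open>D\<close> of the final theorem by
  exchanging \<open>u\<close> and \<open>w\<close>, because those coefficients describe a copy added at the front.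
\<close>

theorem tutte_fan_transfer:
  fixes G :: "('v, 'e) mgraph" and x y :: "'k :: field"
  assumes fin: "finite_mgraph G" and conn: "connected_mgraph G"
    and V: "{v, u, w} \<subseteq> verts G" "v \<noteq> u" "v \<noteq> w" "u \<noteq> w"
    and xy: "x \<noteq> 1" "y \<noteq> 1" "x * y - x - y \<noteq> 0"
  defines "T0 \<equiv> tutte G x y" and "T' \<equiv> \<lambda>A. tutte (identify G A) x y" and "K \<equiv> x * y - x - y"
  obtains \<sigma> where "tutte (fan 1 G v u w) x y = T0" and "\<sigma> 1 = T' {v, w}"
    and "\<And>n. n \<ge> 1 \<Longrightarrow> tutte (fan (Suc n) G v u w) x y =
       ((x * y - x - 1) * T0 - T' {v, u}) / K * tutte (fan n G v u w) x y +
       ((x - 1) * T' {v, u} - T0) / K * \<sigma> n"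
    and "\<And>n. n \<ge> 1 \<Longrightarrow> \<sigma> (Suc n) =
       ((x * y - x - 1) * T' {v, w} - T' {v, u, w}) / K * tutte (fan n G v u w) x y +
       ((x - 1) * T' {v, u, w} - T' {v, w}) / K * \<sigma> n"
proof -
  define h where "h = x - 1"
  define t where "t = y - 1"
  define q where "q = h * t"
  have K: "K = q - 1" "x * y - x - 1 = q + t - 1"
    by (simp_all add: K_def q_def h_def t_def algebra_simps)
  have nz: "h \<noteq> 0" "t \<noteq> 0" "q \<noteq> 0" "q \<noteq> 1"
    using xy K(1) by (auto simp: h_def t_def q_def K_def)
  define Z where "Z = (\<lambda>n B. cut_sum q t (edges (fan n G v u w)) (fan_cuts n G v u w B))"
  define Y where "Y = (\<lambda>R. cut_sum q t (edges G) (rooted_cuts G R))"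
  define \<tau> where "\<tau> = (\<lambda>n. tutte (fan n G v u w) x y)"
  have fV: "finite (verts G)" using fin by (simp add: finite_mgraph_def)
  have "card {v, u, w} \<le> card (verts G)" using V fV by (intro card_mono) auto
  then have "card (verts G) \<ge> 3" using V by simp
  then obtain m where m: "card (verts G) = Suc (Suc (Suc m))"
    by (metis Suc_le_D numeral_3_eq_3 Suc_le_mono)
  have v: "v \<in> verts G" and ne: "u \<noteq> v" "w \<noteq> v" using V by auto
  have Y1: "Y {v} = T0 * (t * (t * t ^ m))"
    using tutte_eq_cut_sum[OF fin conn v, of x y]
    by (simp add: m Y_def T0_def q_def h_def t_def mult.assoc)
  have Y2: "Y {v, a} = T' {v, a} * (t * t ^ m)" if "a \<in> verts G" "a \<noteq> v" for a
    using tutte_identify_eq_cut_sum[OF fin conn, of "{v, a}" x y] that v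
    by (simp add: m Y_def T'_def q_def h_def t_def mult.assoc)
  have Y3: "Y {v, u, w} = T' {v, u, w} * t ^ m"
    using tutte_identify_eq_cut_sum[OF fin conn, of "{v, u, w}" x y] V
    by (simp add: m Y_def T'_def q_def h_def t_def mult.assoc)
  have comm: "{u, v} = {v, u}" "{u, v, w} = {v, u, w}" by auto
  \<comment> \<open>The graph has \<open>m + 3\<close> vertices, hence the fan has \<open>n * (m + 2) + 1\<close>,
    and its quotient has one vertex less; \<open>N n\<close> is the normalising power for the quotient.\<close>
  define N where "N = (\<lambda>n. t ^ (n * (m + 2) - 1))"
  define \<sigma> where "\<sigma> = (\<lambda>n. Z n {w} / N n)"
  have N: "N n \<noteq> 0" "Z n {w} = \<sigma> n * N n" for n
    using nz by (simp_all add: N_def \<sigma>_def)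
  have tN: "t ^ (n * (m + 2)) = t * N n" if "n \<ge> 1" for n
  proof -
    have "n * (m + 2) = Suc (n * (m + 2) - 1)" using that by (cases n) simp_all
    then show ?thesis unfolding N_def by (metis power_Suc)
  qed
  have Z: "Z n {} = \<tau> n * (t * N n)" if "n \<ge> 1" for n
    using tutte_fan_eq_cut_sum[OF fin conn V(1) ne that, of x y] tN[OF that]
    by (simp add: m Z_def \<tau>_def q_def h_def t_def)
  have N1: "N 1 = t * t ^ m" by (simp add: N_def)
  have NSuc: "t * N (Suc n) = (t * N n) * (t * (t * t ^ m))" "N (Suc n) = (t * N n) * (t * t ^ m)"
    if "n \<ge> 1" for n
  proof -
    have "t * N (Suc n) = t ^ (Suc n * (m + 2))" by (rule tN[of "Suc n", symmetric]) simp
    also have "\<dots> = t ^ (n * (m + 2)) * (t * (t * t ^ m))" by (simp add: power_add)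
    finally show *: "t * N (Suc n) = (t * N n) * (t * (t * t ^ m))" by (simp only: tN[OF that])
    then have "t * N (Suc n) = t * ((t * N n) * (t * t ^ m))" by (simp add: mult_ac)
    then show "N (Suc n) = (t * N n) * (t * t ^ m)" using nz by simp
  qed
  have step: "Z (Suc n) B = (1 + t / q) * (Z n {} * Y (insert v B)) +
      t / (q * (q - 1)) * ((q * Z n {w} - Z n {}) * (q * Y (insert u (insert v B)) - Y (insert v B)))"
    if "n \<ge> 1" for n B
    unfolding Z_def Y_def by (rule cut_sum_fan_Suc[OF fin V(1) ne that nz(3,4)])
  have Yu: "Y {v, u} = T' {v, u} * (t * t ^ m)" and Yw: "Y {v, w} = T' {v, w} * (t * t ^ m)"
    using Y2 V by auto
  show thesis
  proof (rule that[of \<sigma>])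
    have "\<tau> 1 * (t * N 1) = Y {v}"
      using Z[of 1] cut_sum_fan_1[OF v ne, of q t "{}"] by (simp add: Z_def Y_def)
    then have "\<tau> 1 * (t * (t * t ^ m)) = T0 * (t * (t * t ^ m))" by (simp only: N1 Y1)
    then show "tutte (fan 1 G v u w) x y = T0" using nz by (simp add: \<tau>_def)
    have "\<sigma> 1 * N 1 = Y {v, w}"
      using N(2)[of 1] cut_sum_fan_1[OF v ne, of q t "{w}"] by (simp add: Z_def Y_def)
    then have "\<sigma> 1 * (t * t ^ m) = T' {v, w} * (t * t ^ m)" by (simp only: N1 Yw)
    then show "\<sigma> 1 = T' {v, w}" using nz by simp
  next
    fix n :: nat assume n: "n \<ge> 1"
    have "\<tau> (Suc n) * (t * N (Suc n)) =
      (((q + t - 1) * T0 - T' {v, u}) / (q - 1) * \<tau> n + (h * T' {v, u} - T0) / (q - 1) * \<sigma> n)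
        * ((t * N n) * (t * (t * t ^ m)))"
      using Z[of "Suc n"] step[OF n, of "{}"]
      by (simp only: comm Z[OF n] N(2) Y1 Yu transfer_algebra[OF nz(1,2) q_def nz(4)])
    then show "tutte (fan (Suc n) G v u w) x y =
       ((x * y - x - 1) * T0 - T' {v, u}) / K * tutte (fan n G v u w) x y +
       ((x - 1) * T' {v, u} - T0) / K * \<sigma> n"
      using nz N(1)[of n] unfolding NSuc[OF n] K by (simp add: \<tau>_def h_def)
    have "\<sigma> (Suc n) * N (Suc n) =
      (((q + t - 1) * T' {v, w} - T' {v, u, w}) / (q - 1) * \<tau> n
        + (h * T' {v, u, w} - T' {v, w}) / (q - 1) * \<sigma> n) * ((t * N n) * (t * t ^ m))"
      using N(2)[of "Suc n"] step[OF n, of "{w}"]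
      by (simp only: comm Z[OF n] N(2) Yw Y3 transfer_algebra[OF nz(1,2) q_def nz(4)])
    then show "\<sigma> (Suc n) =
       ((x * y - x - 1) * T' {v, w} - T' {v, u, w}) / K * tutte (fan n G v u w) x y +
       ((x - 1) * T' {v, u, w} - T' {v, w}) / K * \<sigma> n"
      using nz N(1)[of n] unfolding NSuc(2)[OF n] K by (simp add: \<tau>_def h_def)
  qed
qed

section \<open>The discriminant\<close>

text \<open>
  If the two eigenvalues agreed, the quotients in the final theorem would be divisions by zero. The
  discriminant must therefore be shown to be nonzero in the field of rational functions. Up to the
  square of the denominator \<open>K\<close> it is a polynomial in the indeterminates, and its value at \<open>x = 2\<close>,
  \<open>y = 3\<close> is a square plus four times a product of two positive numbers. At this point \<open>x - 1\<close> and
  \<open>x * y - x - y\<close> are \<open>1\<close>, and \<open>x * y - x - 1\<close> is \<open>3\<close>.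
\<close>

lemma discriminant_identity:
  fixes A B C D :: "'k :: comm_ring_1"
  assumes "K * A = a" "K * B = b" "K * C = c" "K * D = d"
  shows "K ^ 2 * ((A - D) ^ 2 + 4 * B * C) = (a - d) ^ 2 + 4 * b * c"
  by (simp add: assms[symmetric] power2_eq_square algebra_simps)

lemma tutte_ring_hom:
  fixes H :: "('v, 'e) mgraph" and x y :: "'a :: comm_ring_1"
  assumes "f 0 = 0" "f 1 = 1" "\<And>a b. f (a + b) = f a + f b" "\<And>a b. f (a - b) = f a - f b"
    "\<And>a b. f (a * b) = f a * f b"
  shows "f (tutte H x y) = tutte H (f x) (f y)"
proof -
  have sum: "f (sum g A) = (\<Sum>a\<in>A. f (g a))" for g :: "'e set \<Rightarrow> 'a" and A
    by (induction A rule: infinite_finite_induct) (simp_all add: assms)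
  have power: "f (a ^ n) = f a ^ n" for a n
    by (induction n) (simp_all add: assms)
  show ?thesis by (simp add: tutte_def sum power assms)
qed

text \<open>
  A new root \<open>a\<close> leaves the dimension of a cut space unchanged or lowers it by one. The last
  inequality is strict because the full edge set of a connected graph has dimension \<open>0\<close> already.
\<close>

lemma cut_sum_root_bounds:
  fixes G :: "('v, 'e) mgraph"
  assumes fin: "finite_mgraph G" and conn: "connected_mgraph G" and R: "r \<in> R" "r \<in> verts G"
  defines "Y \<equiv> \<lambda>R. cut_sum 2 2 (edges G) (rooted_cuts G R) :: rat"
  shows "0 < Y R" "Y (insert a R) \<le> Y R" "Y R < 2 * Y (insert a R)"
proof -
  have fV: "finite (verts G)" and fE: "finite (edges G)"
    using fin by (simp_all add: finite_mgraph_def)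
  have dim: "dim2 (rooted_cuts G (insert a R) S) \<le> dim2 (rooted_cuts G R S)"
    "dim2 (rooted_cuts G R S) \<le> Suc (dim2 (rooted_cuts G (insert a R) S))" for S
    using dim2_kernel_le[OF cut_space_rooted_cuts[OF fV, of R S] xor_linear_mem[of a]]
    by (simp_all only: rooted_cuts_insert_root)
  show "0 < Y R"
    unfolding Y_def cut_sum_def using fE by (intro sum_pos) auto
  show "Y (insert a R) \<le> Y R"
    unfolding Y_def cut_sum_def
    by (intro sum_mono mult_right_mono power_increasing dim) auto
  have full: "dim2 (rooted_cuts G R' (edges G)) = 0" if "r \<in> R'" for R'
  proof -
    have "rooted_cuts G R' (edges G) \<subseteq> rooted_cuts G {r} (edges G)"
      using that by (auto simp: rooted_cuts_def)
    also have "\<dots> = {{}}" using connected_iff_rooted_cuts[OF fin R(2)] conn by blast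
    finally have "rooted_cuts G R' (edges G) = {{}}" by (auto simp: rooted_cuts_def)
    then show ?thesis by (intro dim2_eqI) simp
  qed
  show "Y R < 2 * Y (insert a R)"
    unfolding Y_def cut_sum_def sum_distrib_left
  proof (rule sum_strict_mono_ex1)
    have "(2::rat) ^ dim2 (rooted_cuts G R S) \<le> 2 ^ Suc (dim2 (rooted_cuts G (insert a R) S))" for S
      by (intro power_increasing dim) auto
    then have le: "(2::rat) ^ dim2 (rooted_cuts G R S) * 2 ^ card S \<le>
        2 ^ Suc (dim2 (rooted_cuts G (insert a R) S)) * 2 ^ card S" for S
      by (intro mult_right_mono) auto
    show "\<forall>S\<in>Pow (edges G). 2 ^ dim2 (rooted_cuts G R S) * 2 ^ card S \<le>
        (2::rat) * (2 ^ dim2 (rooted_cuts G (insert a R) S) * 2 ^ card S)"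
      using le by (simp add: mult.assoc)
    show "\<exists>S\<in>Pow (edges G). 2 ^ dim2 (rooted_cuts G R S) * 2 ^ card S <
        (2::rat) * (2 ^ dim2 (rooted_cuts G (insert a R) S) * 2 ^ card S)"
      using R by (intro bexI[of _ "edges G"]) (simp_all add: full)
  qed (use fE in simp)
qed

text \<open>
  The first inequality says that the numerator of \<open>B\<close> is positive at \<open>x = 2\<close>, \<open>y = 3\<close>, the second
  one that the numerator of \<open>C\<close> is.
\<close>

lemma tutte_2_3_inequalities:
  fixes G :: "('v, 'e) mgraph"
  assumes fin: "finite_mgraph G" and conn: "connected_mgraph G"
    and V: "{v, u, w} \<subseteq> verts G" "v \<noteq> u" "v \<noteq> w" "u \<noteq> w"
  shows "tutte G 2 3 < tutte (identify G {v, w}) 2 (3::rat)"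
    and "tutte (identify G {v, u, w}) 2 3 < 3 * tutte (identify G {v, u}) 2 (3::rat)"
proof -
  have fV: "finite (verts G)" using fin by (simp add: finite_mgraph_def)
  have "card {v, u, w} \<le> card (verts G)" using V fV by (intro card_mono) auto
  then have "card (verts G) \<ge> 3" using V by simp
  then obtain m where m: "card (verts G) = Suc (Suc (Suc m))"
    by (metis Suc_le_D numeral_3_eq_3 Suc_le_mono)
  have v: "v \<in> verts G" using V by simp
  define Y where "Y = (\<lambda>R. cut_sum 2 2 (edges G) (rooted_cuts G R) :: rat)"
  have p: "(0::rat) < 2 ^ m" by simp
  have bounds: "0 < Y R" "Y (insert a R) \<le> Y R" "Y R < 2 * Y (insert a R)" if "v \<in> R" for a R
    unfolding Y_def by (rule cut_sum_root_bounds[OF fin conn that v])+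
  have Y1: "tutte G 2 3 * (4 * 2 ^ m) = Y {v}"
    using tutte_eq_cut_sum[OF fin conn v, of 2 "3::rat"] by (simp add: m Y_def)
  have Y2: "tutte (identify G {v, a}) 2 3 * (2 * 2 ^ m) = Y {v, a}" if "a \<in> verts G" "a \<noteq> v" for a
    using tutte_identify_eq_cut_sum[OF fin conn, of "{v, a}" 2 "3::rat"] that v by (simp add: m Y_def)
  have Y3: "tutte (identify G {v, u, w}) 2 3 * 2 ^ m = Y {v, u, w}"
    using tutte_identify_eq_cut_sum[OF fin conn, of "{v, u, w}" 2 "3::rat"] V by (simp add: m Y_def)
  have "Y {v} < 2 * Y {v, w}" using bounds(3)[of "{v}" w] by (simp add: insert_commute)
  then have "tutte G 2 (3::rat) * (4 * 2 ^ m) < tutte (identify G {v, w}) 2 3 * (4 * 2 ^ m)"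
    using Y1 Y2[of w] V by (simp add: algebra_simps)
  then show "tutte G 2 3 < tutte (identify G {v, w}) 2 (3::rat)"
    using p by (simp only: mult_less_cancel_right_pos)
  have "Y {v, u, w} \<le> Y {v, u}" using bounds(2)[of "{v, u}" w] by (simp add: insert_commute)
  moreover have "0 < Y {v, u}" using bounds(1)[of "{v, u}"] by simp
  ultimately have "2 * Y {v, u, w} < 3 * Y {v, u}" by linarith
  then have "tutte (identify G {v, u, w}) 2 (3::rat) * (2 * 2 ^ m) <
      3 * tutte (identify G {v, u}) 2 3 * (2 * 2 ^ m)"
    using Y2[of u] Y3 V by (simp add: algebra_simps)
  then show "tutte (identify G {v, u, w}) 2 3 < 3 * tutte (identify G {v, u}) 2 (3::rat)"
    using p by simp
qed

text \<open>
  Two ring homomorphisms from the polynomial ring: the inclusion into the algebraic closure and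
  the evaluation at \<open>x = 2\<close>, \<open>y = 3\<close>. The inclusion is injective, so a polynomial with nonzero
  evaluation is nonzero in the closure.
\<close>

definition generic :: "rat poly poly \<Rightarrow> ratfun_closure" where
  "generic p = to_ac (to_fract p)"

definition at_2_3 :: "rat poly poly \<Rightarrow> rat" where
  "at_2_3 p = poly (poly p [:3:]) 2"

lemma generic_simps:
  "generic 0 = 0" "generic 1 = 1" "generic (a + b) = generic a + generic b"
  "generic (a - b) = generic a - generic b" "generic (a * b) = generic a * generic b"
  "generic a = 0 \<longleftrightarrow> a = 0"
  by (simp_all add: generic_def)

lemma at_2_3_simps:
  "at_2_3 0 = 0" "at_2_3 1 = 1" "at_2_3 (a + b) = at_2_3 a + at_2_3 b"
  "at_2_3 (a - b) = at_2_3 a - at_2_3 b" "at_2_3 (a * b) = at_2_3 a * at_2_3 b"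
  by (simp_all add: at_2_3_def)

definition poly_x :: "rat poly poly" where "poly_x = [:[:0, 1:]:]"
definition poly_y :: "rat poly poly" where "poly_y = [:0, 1:]"

lemma generic_indet: "generic poly_x = indet_x" "generic poly_y = indet_y"
  by (simp_all add: generic_def poly_x_def poly_y_def indet_x_def indet_y_def)

lemma at_2_3_indet: "at_2_3 poly_x = 2" "at_2_3 poly_y = 3"
  by (simp_all add: at_2_3_def poly_x_def poly_y_def)

lemma generic_nonzero: "at_2_3 p \<noteq> 0 \<Longrightarrow> generic p \<noteq> 0"
  by (auto simp: generic_simps at_2_3_simps)

lemma generic_tutte: "generic (tutte H poly_x poly_y) = T H"
  by (simp add: T_def tutte_ring_hom[where f = generic] generic_simps generic_indet)

lemma at_2_3_tutte: "at_2_3 (tutte H poly_x poly_y) = tutte H 2 3"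
  by (simp add: tutte_ring_hom[where f = at_2_3] at_2_3_simps at_2_3_indet)

lemma generic_discriminant_nonzero:
  fixes G :: "('v, 'e) mgraph"
  assumes fin: "finite_mgraph G" and conn: "connected_mgraph G"
    and V: "{v, u, w} \<subseteq> verts G" "v \<noteq> u" "v \<noteq> w" "u \<noteq> w"
  defines "x \<equiv> indet_x" and "y \<equiv> indet_y" and "T0 \<equiv> T G" and "T' \<equiv> \<lambda>A. T (identify G A)"
  shows "((x * y - x - 1) * T0 - T' {v, w} - ((x - 1) * T' {v, u, w} - T' {v, u})) ^ 2 +
    4 * ((x - 1) * T' {v, w} - T0) * ((x * y - x - 1) * T' {v, u} - T' {v, u, w}) \<noteq> 0"
proof -
  let ?x = poly_x and ?y = poly_y
  let ?g = "tutte G ?x ?y" and ?t = "\<lambda>A. tutte (identify G A) ?x ?y"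
  let ?a = "(?x * ?y - ?x - 1) * ?g - ?t {v, w} - ((?x - 1) * ?t {v, u, w} - ?t {v, u})"
  let ?b = "(?x - 1) * ?t {v, w} - ?g" and ?c = "(?x * ?y - ?x - 1) * ?t {v, u} - ?t {v, u, w}"
  \<comment> \<open>The factor four is a sum of ones because a ring homomorphism is evaluated on it.\<close>
  let ?p = "?a * ?a + (1 + 1 + 1 + 1) * ?b * ?c"
  have pos: "at_2_3 ?b > 0" "at_2_3 ?c > 0"
    using tutte_2_3_inequalities[OF fin conn V]
    by (simp_all add: at_2_3_simps at_2_3_tutte at_2_3_indet)
  have "at_2_3 ?p = at_2_3 ?a * at_2_3 ?a + 4 * at_2_3 ?b * at_2_3 ?c"
    by (simp only: at_2_3_simps) simp
  also have "\<dots> > 0" using pos by (simp add: add_nonneg_pos)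
  finally have "generic ?p \<noteq> 0" by (intro generic_nonzero) simp
  moreover have "generic 4 = 4"
  proof -
    have "generic (1 + 1 + 1 + 1) = 1 + 1 + 1 + 1" by (simp only: generic_simps)
    then show ?thesis by simp
  qed
  ultimately show ?thesis
    by (simp add: generic_simps generic_tutte generic_indet x_def y_def T0_def T'_def power2_eq_square)
qed

lemma indet_nonzero:
  "indet_x \<noteq> 1" "indet_y \<noteq> 1" "indet_x * indet_y - indet_x - indet_y \<noteq> 0" "(2 :: ratfun_closure) \<noteq> 0"
proof -
  show "indet_x \<noteq> 1"
    using generic_nonzero[of "poly_x - 1"] by (simp add: at_2_3_simps at_2_3_indet generic_simps generic_indet)
  show "indet_y \<noteq> 1"
    using generic_nonzero[of "poly_y - 1"] by (simp add: at_2_3_simps at_2_3_indet generic_simps generic_indet)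
  show "indet_x * indet_y - indet_x - indet_y \<noteq> 0"
    using generic_nonzero[of "poly_x * poly_y - poly_x - poly_y"]
    by (simp add: at_2_3_simps at_2_3_indet generic_simps generic_indet)
  show "(2 :: ratfun_closure) \<noteq> 0"
    using generic_nonzero[of "1 + 1"] by (simp add: at_2_3_simps generic_simps)
qed

section \<open>The fan-like graph\<close>

theorem theorem3p6:
  fixes G :: "('v, 'e) mgraph" and v u w :: 'v and n :: nat
    and x y A B C D s lam\<^sub>1 lam\<^sub>2 :: ratfun_closure
  assumes "finite_mgraph G" and "connected_mgraph G"
    and "{v, u, w} \<subseteq> verts G" and "v \<noteq> u" and "v \<noteq> w" and "u \<noteq> w"
    and "n \<ge> 1"
    and "x = indet_x" and "y = indet_y"
    and "A = 1 / (x * y - x - y) *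
               ((x * y - x - 1) * T G - T (identify G {v, w}))"
    and "B = 1 / (x * y - x - y) *
               ((x - 1) * T (identify G {v, w}) - T G)"
    and "C = 1 / (x * y - x - y) *
               ((x * y - x - 1) * T (identify G {v, u}) - T (identify G {v, u, w}))"
    and "D = 1 / (x * y - x - y) *
               ((x - 1) * T (identify G {v, u, w}) - T (identify G {v, u}))"
    and "s ^ 2 = (A - D) ^ 2 + 4 * B * C"
    and "lam\<^sub>1 = (A + D + s) / 2" and "lam\<^sub>2 = (A + D - s) / 2"
  shows "T (fan n G v u w) =
           T G * ((lam\<^sub>1 ^ n - lam\<^sub>2 ^ n) / (lam\<^sub>1 - lam\<^sub>2))
           + (B * T (identify G {v, u}) - D * T G)
             * ((lam\<^sub>1 ^ (n - 1) - lam\<^sub>2 ^ (n - 1)) / (lam\<^sub>1 - lam\<^sub>2))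
       \<and> T (fan n G v u w) =
           (B * T (identify G {v, u}) - D * T G)
             * (\<Sum>j\<in>{j::nat. int j \<le> (int n - 2) div 2}.
                 of_nat ((n - j - 2) choose j) * (A + D) ^ (n - 2 * j - 2) * (B * C - A * D) ^ j)
           + T G
             * (\<Sum>j\<in>{j::nat. int j \<le> (int n - 1) div 2}.
                 of_nat ((n - j - 1) choose j) * (A + D) ^ (n - 2 * j - 1) * (B * C - A * D) ^ j)"
proof -
  let ?K = "x * y - x - y" and ?F = "\<lambda>n. T (fan n G v u w)"
  let ?TG = "T G" and ?Tw = "T (identify G {v, w})" and ?Tu = "T (identify G {v, u})"
    and ?Tuw = "T (identify G {v, u, w})"
  let ?p = "A + D" and ?r = "B * C - A * D"
  note xy = indet_nonzero(1-3)[folded assms(8,9)]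
  note two = indet_nonzero(4)
  have K: "?K \<noteq> 0" by (rule xy(3))
  obtain \<sigma> where F1: "?F 1 = ?TG" and \<sigma>1: "\<sigma> 1 = ?Tw"
    and F_Suc: "\<And>n. n \<ge> 1 \<Longrightarrow> ?F (Suc n) =
       ((x * y - x - 1) * ?TG - ?Tu) / ?K * ?F n + ((x - 1) * ?Tu - ?TG) / ?K * \<sigma> n"
    and \<sigma>_Suc: "\<And>n. n \<ge> 1 \<Longrightarrow> \<sigma> (Suc n) =
       ((x * y - x - 1) * ?Tw - ?Tuw) / ?K * ?F n + ((x - 1) * ?Tuw - ?Tw) / ?K * \<sigma> n"
    using tutte_fan_transfer[OF assms(1-6) xy] unfolding T_def assms(8,9) by blast
  define a b c d where "a = ((x * y - x - 1) * ?TG - ?Tu) / ?K" and "b = ((x - 1) * ?Tu - ?TG) / ?K"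
    and "c = ((x * y - x - 1) * ?Tw - ?Tuw) / ?K" and "d = ((x - 1) * ?Tuw - ?Tw) / ?K"
  note F_Suc = F_Suc[folded a_def b_def] and \<sigma>_Suc = \<sigma>_Suc[folded c_def d_def]
  \<comment> \<open>The transfer matrix of the last copy and the matrix with the entries \<open>A\<close>, \<open>B\<close>, \<open>C\<close>, \<open>D\<close>
    have the same trace and determinant, hence the same second-order recurrence.\<close>
  have trace: "a + d = ?p"
    unfolding a_def d_def assms(10,13) by (simp add: add_divide_distrib[symmetric])
  have det: "b * c - a * d = ?r"
    unfolding a_def b_def c_def d_def assms(10-13)
    by (simp add: diff_divide_distrib[symmetric]) (simp add: algebra_simps)
  have F2: "?F 2 = A * ?TG + B * ?Tu"
    using F_Suc[of 1] F1 \<sigma>1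
    unfolding a_def b_def assms(10,11)
    by (simp add: numeral_2_eq_2 add_divide_distrib[symmetric]) (simp add: algebra_simps)
  have "?F (Suc (Suc k)) = ?p * ?F (Suc k) + ?r * ?F k" if "k \<ge> 1" for k
  proof -
    have "?F (Suc (Suc k)) = a * ?F (Suc k) + b * (c * ?F k + d * \<sigma> k)"
      using F_Suc[of "Suc k"] \<sigma>_Suc[OF that] that by simp
    \<comment> \<open>The Cayley-Hamilton theorem for the transfer matrix.\<close>
    also have "\<dots> = (a + d) * (a * ?F k + b * \<sigma> k) + (b * c - a * d) * ?F k + a * (?F (Suc k) - (a * ?F k + b * \<sigma> k))"
      by (simp add: algebra_simps)
    also have "\<dots> = (a + d) * ?F (Suc k) + (b * c - a * d) * ?F k"
      using F_Suc[OF that] by simp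
    finally show ?thesis by (simp only: trace det)
  qed
  from recurrence_eq_lucas_U[of ?F, OF this]
  have F: "?F n = ?TG * lucas_U ?p ?r n + (B * ?Tu - D * ?TG) * lucas_U ?p ?r (n - 1)"
    using assms(7) F1 F2 by (cases n) (simp_all add: algebra_simps)
  have "?K ^ 2 * s ^ 2 \<noteq> 0"
  proof -
    have "?K ^ 2 * s ^ 2 = ((x * y - x - 1) * ?TG - ?Tw - ((x - 1) * ?Tuw - ?Tu)) ^ 2 +
        4 * ((x - 1) * ?Tw - ?TG) * ((x * y - x - 1) * ?Tu - ?Tuw)"
      unfolding assms(14) by (rule discriminant_identity) (use K in \<open>simp_all add: assms(10-13)\<close>)
    also have "\<dots> \<noteq> 0"
      using generic_discriminant_nonzero[OF assms(1-6)] by (simp only: assms(8,9) not_False_eq_True)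
    finally show ?thesis .
  qed
  then have s: "s \<noteq> 0" by auto
  have "lam\<^sub>1 - lam\<^sub>2 = s"
    using two unfolding assms(15,16) by (simp add: field_simps)
  then have ne: "lam\<^sub>1 \<noteq> lam\<^sub>2" using s by auto
  have sum: "?p = lam\<^sub>1 + lam\<^sub>2"
    using two unfolding assms(15,16) by (simp add: field_simps)
  have "4 * (lam\<^sub>1 * lam\<^sub>2) = (A + D) ^ 2 - s ^ 2"
    using two unfolding assms(15,16) by (simp add: field_simps power2_eq_square)
  then have "4 * (lam\<^sub>1 * lam\<^sub>2) = 4 * - ?r"
    unfolding assms(14) by (simp add: power2_eq_square algebra_simps)
  moreover have "(4 :: ratfun_closure) \<noteq> 0"
    using two by (metis mult_2 mult_eq_0_iff numeral_Bit0)
  ultimately have prod: "?r = - (lam\<^sub>1 * lam\<^sub>2)" by (metis mult_left_cancel minus_minus)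
  have quotient: "lucas_U ?p ?r k = (lam\<^sub>1 ^ k - lam\<^sub>2 ^ k) / (lam\<^sub>1 - lam\<^sub>2)" for k
    by (rule lucas_U_eq_quotient[OF ne sum prod])
  have shift: "int n - 2 = int (n - 1) - 1" "n - k - 2 = n - 1 - k - 1" for k
    using assms(7) by auto
  show ?thesis
  proof
    show "?F n = ?TG * ((lam\<^sub>1 ^ n - lam\<^sub>2 ^ n) / (lam\<^sub>1 - lam\<^sub>2))
        + (B * ?Tu - D * ?TG) * ((lam\<^sub>1 ^ (n - 1) - lam\<^sub>2 ^ (n - 1)) / (lam\<^sub>1 - lam\<^sub>2))"
      by (simp only: F quotient)
    show "?F n = (B * ?Tu - D * ?TG)
        * (\<Sum>j\<in>{j::nat. int j \<le> (int n - 2) div 2}.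
             of_nat ((n - j - 2) choose j) * (A + D) ^ (n - 2 * j - 2) * (B * C - A * D) ^ j)
      + ?TG
        * (\<Sum>j\<in>{j::nat. int j \<le> (int n - 1) div 2}.
             of_nat ((n - j - 1) choose j) * (A + D) ^ (n - 2 * j - 1) * (B * C - A * D) ^ j)"
      unfolding F shift lucas_U_eq_sum[of ?p ?r] by (rule add.commute)
  qed
qed

end
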